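(* Consider the distributed event-triggered gradient-push algorithm described in the context. Suppose that: (1) for each $i\in\{1,\dots,m\}$ there is $D_i>0$ such that $\|\nabla f_i(x)\|\le D_i$ for all $x\in\mathbb{R}^d$; (2) the graph sequence $\{\mathcal{G}(t)\}_{t\ge 0}$ is uniformly strongly connected, i.e. there is $B\in\mathbb{N}$ such that for every integer $k\ge 0$ the graph on $\mathcal{V}$ with edge set $\bigcup_{i=kB}^{(k+1)B-1}\mathcal{E}(i)$ is strongly connected; (3) $\{\alpha(t+1)\}_{t\ge 0}$ is monotonically non-increasing with $\sum_{t=0}^\infty \alpha(t+1)=\infty$ and $\sum_{t=0}^\infty\alpha(t+1)^2<\infty$; (4) $\{\tau(t)\}_{t\ge 0}$ is monotonically non-increasing with $\sum_{t=1}^\infty\tau(t)<\infty$; (5) $\{\zeta(t)\}_{t\ge 0}$ is monotonically non-increasing with $\sum_{t=1}^\infty t^{3/2}\zeta(t)<\infty$ and $\sum_{t=1}^\infty\zeta(t)<1$. Then there exists $x^*\in X^*$ such that $\lim_{t\to\infty}\hat z_i(t)=x^*$ for all $i\in\{1,\dots,m\}$.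
   Context: Problem. There are $m$ agents $\mathcal{V}=\{1,\dots,m\}$; agent $i$ has a convex differentiable cost $f_i:\mathbb{R}^d\to\mathbb{R}$. Put $f=\sum_{i=1}^m f_i$, let $f^*=\min_{x\in\mathbb{R}^d} f(x)$, and $X^*=\{x\in\mathbb{R}^d: f(x)=f^*\}$, which is assumed nonempty. $\|\cdot\|$ is the Euclidean norm. Graphs. For each integer $t\ge 0$, $\mathcal{G}(t)=(\mathcal{V},\mathcal{E}(t))$ is a directed graph; $(i,j)\in\mathcal{E}(t)$ means that $i$ can send messages to $j$. Let $N_i^{\mathrm{in}}(t)=\{j:(j,i)\in\mathcal{E}(t)\}\cup\{i\}$, $N_i^{\mathrm{out}}(t)=\{j:(i,j)\in\mathcal{E}(t)\}\cup\{i\}$, $d_i^{\mathrm{out}}(t)=|N_i^{\mathrm{out}}(t)|$, and let $A(t)=(a_{ij}(t))\in\mathbb{R}^{m\times m}$ be the column stochastic matrix with $a_{ij}(t)=1/d_j^{\mathrm{out}}(t)$ if $j\in N_i^{\mathrm{in}}(t)$ and $a_{ij}(t)=0$ otherwise. Algorithm. Given stepsizes $\alpha(t)>0$ ($t\ge1$) and triggering thresholds $\tau(t),\zeta(t)\ge 0$ ($t\ge 0$), let $x_i(0)\in\mathbb{R}^d$ be arbitrary, $\hat x_i(0)=x_i(0)$, and $y_i(0)=\hat y_i(0)=1$. For $t=0,1,2,\dots$ and each $i$ set $\hat w_i(t+1)=\sum_{j=1}^m a_{ij}(t)\hat x_j(t)$, $\; y_i(t+1)=\sum_{j=1}^m a_{ij}(t)\hat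 y_j(t)$, $\; \hat z_i(t+1)=\hat w_i(t+1)/y_i(t+1)$, $\; x_i(t+1)=\hat w_i(t+1)-\alpha(t+1)\nabla f_i(\hat z_i(t+1))$; then $\hat x_i(t+1)=x_i(t+1)$ if $\|x_i(t+1)-\hat x_i(t)\|\ge\tau(t+1)$ and $\hat x_i(t+1)=\hat x_i(t)$ otherwise; and $\hat y_i(t+1)=y_i(t+1)$ if $|y_i(t+1)-\hat y_i(t)|\ge\zeta(t+1)$ and $\hat y_i(t+1)=\hat y_i(t)$ otherwise. *)

theory Defs
  imports "Graph_Theory.Digraph_Component" "HOL-Analysis.Analysis"
begin

text \<open>The agents are the elements of a finite type \<open>'v\<close>, and \<open>E :: ('v \<times> 'v) set\<close> is the edge set of
  a directed graph on all of \<open>'v\<close>; \<open>(i, j) \<in> E\<close> means that \<open>i\<close> can send to \<open>j\<close>.\<close>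

definition in_nbrs :: "('v \<times> 'v) set \<Rightarrow> 'v \<Rightarrow> 'v set" where
  "in_nbrs E i = {j. (j, i) \<in> E} \<union> {i}"

definition out_nbrs :: "('v \<times> 'v) set \<Rightarrow> 'v \<Rightarrow> 'v set" where
  "out_nbrs E i = {j. (i, j) \<in> E} \<union> {i}"

definition out_degree :: "('v \<times> 'v) set \<Rightarrow> 'v \<Rightarrow> nat" where
  "out_degree E i = card (out_nbrs E i)"

definition push_matrix :: "('v::finite \<times> 'v) set \<Rightarrow> real^'v^'v" where
  "push_matrix E = (\<chi> i j. if j \<in> in_nbrs E i then 1 / real (out_degree E j) else 0)"

definition uniformly_strongly_connected :: "(nat \<Rightarrow> ('v \<times> 'v) set) \<Rightarrow> bool" where
  "uniformly_strongly_connected E \<longleftrightarrow>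
     (\<exists>B>0. \<forall>k. strongly_connected
        (with_proj \<lparr> pverts = UNIV, parcs = (\<Union>t\<in>{k * B..<(k + 1) * B}. E t) \<rparr>))"

text \<open>Only meaningful where \<open>f\<close> is differentiable; see \<open>GDERIV_gradient\<close>.\<close>

definition gradient :: "('a::euclidean_space \<Rightarrow> real) \<Rightarrow> 'a \<Rightarrow> 'a" where
  "gradient f x = (THE g. GDERIV f x :> g)"

lemma GDERIV_gradient:
  fixes f :: "'a::euclidean_space \<Rightarrow> real"
  assumes "f differentiable at x"
  shows "GDERIV f x :> gradient f x"
proof -
  from assms obtain f' where f': "(f has_derivative f') (at x)"
    unfolding differentiable_def by blast
  then have lin: "linear f'"
    by (rule has_derivative_linear)
  define g where "g = (\<Sum>b\<in>Basis. f' b *\<^sub>R b)"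
  have "f' = (\<lambda>h. h \<bullet> g)"
  proof
    fix h
    have "f' h = f' (\<Sum>b\<in>Basis. (h \<bullet> b) *\<^sub>R b)"
      by (simp add: euclidean_representation)
    also have "\<dots> = (\<Sum>b\<in>Basis. (h \<bullet> b) * f' b)"
      by (simp add: linear_sum[OF lin] linear_scale[OF lin])
    also have "\<dots> = h \<bullet> g"
      by (simp add: g_def inner_sum_right mult.commute)
    finally show "f' h = h \<bullet> g" .
  qed
  with f' have g: "GDERIV f x :> g"
    by (simp add: gderiv_def)
  have "g' = g" if "GDERIV f x :> g'" for g'
  proof -
    have "(\<lambda>h. h \<bullet> g') = (\<lambda>h. h \<bullet> g)"
      using that g unfolding gderiv_def by (rule has_derivative_unique)
    then have "(g' - g) \<bullet> g' = (g' - g) \<bullet> g"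
      by (rule fun_cong)
    then have "(g' - g) \<bullet> (g' - g) = 0"
      by (simp only: inner_diff_right diff_self)
    then show ?thesis
      by (simp only: inner_eq_zero_iff right_minus_eq)
  qed
  with g show ?thesis
    unfolding gradient_def by (rule theI)
qed

definition minimizers :: "('a \<Rightarrow> real) \<Rightarrow> 'a set" where
  "minimizers f = {x. is_arg_min f (\<lambda>_. True) x}"

text \<open>In \<open>event_triggered_gradient_push\<close> the first argument of each sequence is time, the second the
  agent; \<open>xh\<close>, \<open>yh\<close>, \<open>wh\<close>, \<open>zh\<close> are the hatted variables. The initial values \<open>x 0\<close> are arbitrary,
  and \<open>wh 0\<close>, \<open>zh 0\<close> are unconstrained and never used.\<close>

definition event_triggered_gradient_push ::
  "('v::finite \<Rightarrow> real^'d \<Rightarrow> real) \<Rightarrow> (nat \<Rightarrow> ('v \<times> 'v) set) \<Rightarrow>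
   (nat \<Rightarrow> real) \<Rightarrow> (nat \<Rightarrow> real) \<Rightarrow> (nat \<Rightarrow> real) \<Rightarrow>
   (nat \<Rightarrow> 'v \<Rightarrow> real^'d) \<Rightarrow> (nat \<Rightarrow> 'v \<Rightarrow> real^'d) \<Rightarrow> (nat \<Rightarrow> 'v \<Rightarrow> real) \<Rightarrow> (nat \<Rightarrow> 'v \<Rightarrow> real) \<Rightarrow>
   (nat \<Rightarrow> 'v \<Rightarrow> real^'d) \<Rightarrow> (nat \<Rightarrow> 'v \<Rightarrow> real^'d) \<Rightarrow> bool"
where
  "event_triggered_gradient_push f E \<alpha> \<tau> \<zeta> x xh y yh wh zh \<longleftrightarrow>
     (\<forall>i. xh 0 i = x 0 i \<and> y 0 i = 1 \<and> yh 0 i = 1) \<and>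
     (\<forall>t i.
        wh (t + 1) i = (\<Sum>j\<in>UNIV. push_matrix (E t) $ i $ j *\<^sub>R xh t j) \<and>
        y (t + 1) i = (\<Sum>j\<in>UNIV. push_matrix (E t) $ i $ j * yh t j) \<and>
        zh (t + 1) i = wh (t + 1) i /\<^sub>R y (t + 1) i \<and>
        x (t + 1) i = wh (t + 1) i - \<alpha> (t + 1) *\<^sub>R gradient (f i) (zh (t + 1) i) \<and>
        xh (t + 1) i =
          (if norm (x (t + 1) i - xh t i) \<ge> \<tau> (t + 1) then x (t + 1) i else xh t i) \<and>
        yh (t + 1) i =
          (if \<bar>y (t + 1) i - yh t i\<bar> \<ge> \<zeta> (t + 1) then y (t + 1) i else yh t i))"

end

theory Submission
  imports Defs
begin

text \<open>The triggers only perturb the push-sum iteration: with \<open>S t\<close> and \<open>c t\<close> the totals of \<open>xh t\<close> and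
\<open>yh t\<close>, both broadcast sequences satisfy \<open>p (t + 1) = A(t) p t + error\<close>, where the error is at most
\<open>\<zeta> (t + 1)\<close> per agent for \<open>yh\<close>, and at most \<open>\<tau> (t + 1)\<close> plus the gradient step for \<open>xh\<close>.  Since \<open>A(t)\<close>
is column stochastic, totals change only through these errors.  In particular \<open>c t\<close> starts at the
number \<open>m\<close> of agents and converges to a limit \<open>cinf \<ge> m (1 - \<Sum>\<zeta>) > 0\<close>.

Consensus.  Let \<open>w t\<close> be what the unperturbed iteration makes of the uniform distribution
(\<open>push_weight\<close>).  The part of \<open>p t\<close> that is not a multiple of \<open>w t\<close> has total zero, and over a long
enough window the product of the push matrices has all entries \<open>\<ge> \<eta> > 0\<close>; hence this part shrinks by
the factor \<open>1 - m \<eta>\<close> in the \<open>l1\<close> norm, up to the errors inside the window (\<open>spread_contraction\<close>).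
The same lemma applied to \<open>xh\<close> and to \<open>yh\<close> gives \<open>wh (t + 1) \<approx> w (t + 1) S t\<close> and
\<open>y (t + 1) \<approx> w (t + 1) c t\<close>, so the quotient \<open>zh (t + 1)\<close> is close to \<open>u t = S t / cinf\<close> for every
agent.  Positivity of \<open>y\<close> is obtained only from some time \<open>T\<close> on.  What happens before \<open>T\<close> does not
affect convergence, because the gradients are bounded wherever they are evaluated.

Optimality.  Summing the update over the agents shows that \<open>u\<close> performs gradient descent for the sum
of the costs, with step \<open>\<alpha> (t + 1) / cinf\<close>, a summable disturbance of size \<open>\<tau>\<close>, and gradients taken at
the points \<open>zh (t + 1) i\<close> instead of \<open>u t\<close>.  Convexity and bounded gradients make the squared
distance of \<open>u\<close> to any minimizer a quasi-Fejer sequence provided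
\<open>\<Sum> \<alpha> (t + 1) * norm (zh (t + 1) i - u t)\<close> is finite, and then \<open>u\<close> converges to a minimizer
(\<open>perturbed_gradient_descent_converges\<close>).

The finiteness of that sum is where the hypotheses meet.  \<open>S t\<close> may grow like the sum of the steps,
and it multiplies the errors of \<open>y\<close>.  But \<open>\<alpha>\<close> is non-increasing, so
\<open>\<alpha> (t + 1) * (\<Sum>s\<le>t. \<alpha> (s + 1)) \<le> \<Sum> (\<alpha> (s + 1))\<^sup>2\<close> and \<open>\<alpha> (t + 1) * norm (S t)\<close> stays bounded
(\<open>step_times_drift_bounded\<close>).  It remains that the errors of \<open>y\<close> are summable; they contain the
distance of \<open>c t\<close> to its limit, a tail of \<open>\<Sum>\<zeta>\<close>, and these tails are summable because \<open>\<Sum> t * \<zeta> t\<close> is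
finite.  Once \<open>u\<close> has converged, \<open>S\<close> is bounded, and the same estimate gives \<open>zh (t + 1) i - u t \<longlonglongrightarrow> 0\<close>.\<close>

section \<open>Real sequences\<close>

text \<open>Shifting by \<open>W\<close> changes a partial sum of \<open>D\<close> by a bounded amount, so summing the recursion bounds
\<open>\<eta>\<close> times the partial sum.\<close>
lemma summable_delayed_contraction:
  fixes D g :: "nat \<Rightarrow> real"
  assumes nonneg: "\<And>t. 0 \<le> D t" and \<eta>: "0 < \<eta>"
    and step: "\<And>t. D (t + W) \<le> (1 - \<eta>) * D t + g t"
    and g: "summable g" and g_nonneg: "\<And>t. 0 \<le> g t"
  shows "summable D"
proof (rule summableI_nonneg_bounded)
  fix n
  have "(\<Sum>t<n. D t) \<le> (\<Sum>t<n + W. D t)"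
    by (rule sum_mono2) (auto simp: nonneg)
  also have "\<dots> = (\<Sum>t<W. D t) + (\<Sum>t<n. D (t + W))"
  proof (induction n)
    case (Suc n)
    then show ?case by (simp add: ac_simps)
  qed simp
  also have "(\<Sum>t<n. D (t + W)) \<le> (\<Sum>t<n. (1 - \<eta>) * D t + g t)"
    by (rule sum_mono) (rule step)
  also have "\<dots> = (1 - \<eta>) * (\<Sum>t<n. D t) + (\<Sum>t<n. g t)"
    by (simp add: sum.distrib sum_distrib_left)
  also have "(\<Sum>t<n. g t) \<le> suminf g"
    using g by (rule sum_le_suminf) (auto simp: g_nonneg)
  finally have "\<eta> * (\<Sum>t<n. D t) \<le> (\<Sum>t<W. D t) + suminf g"
    by (simp add: algebra_simps)
  then show "(\<Sum>t<n. D t) \<le> ((\<Sum>t<W. D t) + suminf g) / \<eta>"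
    using \<eta> by (simp add: field_simps)
qed (rule nonneg)

text \<open>The excess of \<open>D\<close> over a fixed level obeys, from some time on, the recursion without the term \<open>g\<close>;
it is therefore summable and tends to zero.\<close>
lemma tendsto_zero_delayed_contraction:
  fixes D g :: "nat \<Rightarrow> real"
  assumes nonneg: "\<And>t. 0 \<le> D t" and \<eta>: "0 < \<eta>" "\<eta> \<le> 1"
    and step: "\<And>t. D (t + W) \<le> (1 - \<eta>) * D t + g t"
    and g: "g \<longlonglongrightarrow> 0"
  shows "D \<longlonglongrightarrow> 0"
proof (rule LIMSEQ_I)
  fix r :: real
  assume r: "0 < r"
  have "0 < \<eta> * (r / 2)" using r \<eta> by simp
  from LIMSEQ_D[OF g this] obtain T where T: "\<And>t. t \<ge> T \<Longrightarrow> g t \<le> \<eta> * (r / 2)"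
    by fastforce
  define e where "e t = max 0 (D (t + T) - r / 2)" for t
  have "summable e"
  proof (rule summable_delayed_contraction[where W = W and g = "\<lambda>_. 0"])
    fix t
    have "D (t + W + T) \<le> (1 - \<eta>) * D (t + T) + \<eta> * (r / 2)"
      using step[of "t + T"] T[of "t + T"] by (simp add: ac_simps)
    also have "\<dots> = (1 - \<eta>) * (D (t + T) - r / 2) + r / 2"
      by (simp add: algebra_simps add_divide_distrib[symmetric] diff_divide_distrib)
    finally have "D (t + W + T) - r / 2 \<le> (1 - \<eta>) * (D (t + T) - r / 2)"
      by simp
    also have "\<dots> \<le> (1 - \<eta>) * e t"
      using \<eta> by (intro mult_left_mono) (auto simp: e_def)
    finally show "e (t + W) \<le> (1 - \<eta>) * e t + 0"
      using \<eta> by (auto simp: e_def)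
  qed (use \<eta> in \<open>auto simp: e_def\<close>)
  then have "e \<longlonglongrightarrow> 0" by (rule summable_LIMSEQ_zero)
  then obtain N where N: "\<And>t. t \<ge> N \<Longrightarrow> \<bar>e t\<bar> < r / 2"
    using LIMSEQ_D[of e 0 "r / 2"] r by auto
  have "norm (D t - 0) < r" if "t \<ge> N + T" for t
  proof -
    have "\<bar>e (t - T)\<bar> < r / 2" using that by (intro N) simp
    then have "D t < r" using that by (simp add: e_def max_def split: if_splits)
    then show ?thesis using nonneg[of t] by simp
  qed
  then show "\<exists>no. \<forall>t\<ge>no. norm (D t - 0) < r" by blast
qed

text \<open>A discrete Gronwall inequality, from \<open>1 + b \<le> exp b\<close>.\<close>
lemma bounded_perturbed_growth:
  fixes a b d :: "nat \<Rightarrow> real"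
  assumes nonneg: "\<And>t. 0 \<le> a t" "\<And>t. 0 \<le> b t" "\<And>t. 0 \<le> d t"
    and step: "\<And>t. a (Suc t) \<le> (1 + b t) * a t + d t"
    and b: "summable b" and d: "summable d"
  shows "a t \<le> exp (suminf b) * (a 0 + suminf d)"
proof -
  have "a t \<le> exp (\<Sum>s<t. b s) * (a 0 + (\<Sum>s<t. d s))"
  proof (induction t)
    case (Suc t)
    have "a (Suc t) \<le> (1 + b t) * a t + d t" by (rule step)
    also have "\<dots> \<le> exp (b t) * a t + d t"
      using nonneg(1)[of t] exp_ge_add_one_self[of "b t"] by (intro add_right_mono mult_right_mono)
    also have "\<dots> \<le> exp (b t) * (exp (\<Sum>s<t. b s) * (a 0 + (\<Sum>s<t. d s))) + exp (\<Sum>s<Suc t. b s) * d t"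
    proof (intro add_mono mult_left_mono Suc.IH)
      have "1 \<le> exp (\<Sum>s<Suc t. b s)" using nonneg(2) by (simp add: sum_nonneg)
      then show "d t \<le> exp (\<Sum>s<Suc t. b s) * d t"
        using nonneg(3)[of t] mult_right_mono[of 1 "exp (\<Sum>s<Suc t. b s)" "d t"] by simp
    qed simp
    also have "\<dots> = exp (\<Sum>s<Suc t. b s) * (a 0 + (\<Sum>s<Suc t. d s))"
      by (simp add: exp_add algebra_simps)
    finally show ?case .
  qed simp
  also have "\<dots> \<le> exp (suminf b) * (a 0 + suminf d)"
    using nonneg sum_le_suminf[OF b, of "{..<t}"] sum_le_suminf[OF d, of "{..<t}"]
    by (intro mult_mono) (auto intro!: add_nonneg_nonneg sum_nonneg)
  finally show ?thesis .
qed

text \<open>The deterministic Robbins-Siegmund lemma.  As \<open>a\<close> is bounded, the factor \<open>1 + b t\<close> costs only a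
summable additive term; after subtracting the accumulated terms the sequence is decreasing.\<close>
lemma quasi_fejer_convergence:
  fixes a b c d :: "nat \<Rightarrow> real"
  assumes nonneg: "\<And>t. 0 \<le> a t" "\<And>t. 0 \<le> b t" "\<And>t. 0 \<le> c t" "\<And>t. 0 \<le> d t"
    and step: "\<And>t. a (Suc t) \<le> (1 + b t) * a t - c t + d t"
    and b: "summable b" and d: "summable d"
  shows "convergent a" and "summable c"
proof -
  define M where "M = exp (suminf b) * (a 0 + suminf d)"
  have "a (Suc t) \<le> (1 + b t) * a t + d t" for t
    using step[of t] nonneg(3)[of t] by linarith
  from bounded_perturbed_growth[OF nonneg(1,2,4) this b d] have M: "a t \<le> M" for t
    unfolding M_def .
  define h where "h t = M * b t + d t" for t
  have h: "summable h" unfolding h_def using b d by (intro summable_add summable_mult)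
  have M0: "0 \<le> M" using M[of 0] nonneg(1)[of 0] by linarith
  have h_nonneg: "0 \<le> h t" for t
    unfolding h_def using M0 nonneg(2,4)[of t] by simp
  have step': "a (Suc t) \<le> a t - c t + h t" for t
  proof -
    have "b t * a t \<le> b t * M" using M nonneg by (intro mult_left_mono)
    then show ?thesis using step[of t] by (simp add: h_def algebra_simps)
  qed
  define p where "p t = a t - (\<Sum>s<t. h s)" for t
  have "decseq p"
    unfolding decseq_Suc_iff p_def
  proof
    fix t show "a (Suc t) - (\<Sum>s<Suc t. h s) \<le> a t - (\<Sum>s<t. h s)"
      using step'[of t] nonneg(3)[of t] by simp
  qed
  moreover have "- suminf h \<le> p t" for t
    using sum_le_suminf[OF h, of "{..<t}"] h_nonneg nonneg(1)[of t] by (simp add: p_def)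
  ultimately obtain L where "p \<longlonglongrightarrow> L" using decseq_convergent by blast
  then have "(\<lambda>t. p t + (\<Sum>s<t. h s)) \<longlonglongrightarrow> L + suminf h"
    using summable_LIMSEQ[OF h] by (intro tendsto_add)
  then show "convergent a" by (auto simp: p_def convergent_def)
  show "summable c"
  proof (rule summableI_nonneg_bounded)
    fix n
    have "(\<Sum>t<n. c t) \<le> a 0 - a n + (\<Sum>t<n. h t)"
    proof (induction n)
      case (Suc n) then show ?case using step'[of n] by simp
    qed simp
    also have "\<dots> \<le> a 0 + suminf h"
      using sum_le_suminf[OF h, of "{..<n}"] h_nonneg nonneg(1)[of n] by simp
    finally show "(\<Sum>t<n. c t) \<le> a 0 + suminf h" .
  qed (rule nonneg)
qed

text \<open>The distance to the limit is at most a tail of \<open>h\<close>, and a term \<open>h k\<close> occurs in exactly \<open>k + 1\<close> of the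
tails, which is where the weight in the hypothesis comes from.\<close>
lemma limit_with_summable_error:
  fixes c h :: "nat \<Rightarrow> real"
  assumes increment: "\<And>t. \<bar>c (Suc t) - c t\<bar> \<le> h t"
    and h: "summable (\<lambda>t. real (Suc t) * h t)"
  obtains L where "c \<longlonglongrightarrow> L" and "summable (\<lambda>t. \<bar>c t - L\<bar>)"
proof -
  have h_nonneg: "0 \<le> h t" for t
    using increment[of t] by linarith
  have sh: "summable h"
  proof (rule summable_comparison_test'[OF h, of 0])
    show "norm (h t) \<le> real (Suc t) * h t" for t
      using h_nonneg[of t] by (simp add: distrib_right)
  qed
  have "summable (\<lambda>t. c (Suc t) - c t)"
    by (rule summable_comparison_test'[OF sh, of 0]) (use increment in auto)
  then have "(\<lambda>n. c 0 + (\<Sum>t<n. c (Suc t) - c t)) \<longlonglongrightarrow> c 0 + (\<Sum>t. c (Suc t) - c t)"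
    by (intro tendsto_intros summable_LIMSEQ)
  then obtain L where L: "c \<longlonglongrightarrow> L" by (auto simp: sum_lessThan_telescope)
  define r where "r t = (\<Sum>k. h (k + t))" for t
  have r_Suc: "r t = h t + r (Suc t)" for t
  proof -
    have "(\<Sum>k. h (Suc k + t)) = r t - h t"
      using suminf_split_head[of "\<lambda>k. h (k + t)"] sh by (simp add: r_def summable_iff_shift)
    then show ?thesis by (simp add: r_def)
  qed
  have tail: "\<bar>c t - L\<bar> \<le> r t" for t
  proof -
    have "\<bar>c t - c (n + t)\<bar> \<le> r t" for n
    proof -
      have "\<bar>c t - c (n + t)\<bar> \<le> (\<Sum>k<n. h (k + t))"
      proof (induction n)
        case (Suc n) then show ?case using increment[of "n + t"] by simp
      qed simp
      also have "\<dots> \<le> r t"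
        unfolding r_def using sh h_nonneg by (intro sum_le_suminf) (auto simp: summable_iff_shift)
      finally show ?thesis .
    qed
    moreover have "(\<lambda>n. \<bar>c t - c (n + t)\<bar>) \<longlonglongrightarrow> \<bar>c t - L\<bar>"
      by (intro tendsto_intros LIMSEQ_ignore_initial_segment L)
    ultimately show ?thesis by (intro LIMSEQ_le_const2) auto
  qed
  have "summable (\<lambda>t. \<bar>c t - L\<bar>)"
  proof (rule summableI_nonneg_bounded)
    fix n
    have "(\<Sum>t<n. \<bar>c t - L\<bar>) \<le> (\<Sum>t<n. r t)" by (rule sum_mono) (rule tail)
    also have "\<dots> = (\<Sum>t<n. real (Suc t) * h t) + real n * r n"
    proof (induction n)
      case (Suc n) then show ?case using r_Suc[of n] by (simp add: algebra_simps)
    qed simp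
    also have "real n * r n = (\<Sum>k. real n * h (k + n))"
      unfolding r_def using sh by (intro suminf_mult[symmetric]) (simp add: summable_iff_shift)
    also have "\<dots> \<le> (\<Sum>k. real (Suc (k + n)) * h (k + n))"
    proof (intro suminf_le mult_right_mono summable_mult)
      show "summable (\<lambda>k. h (k + n))" using sh by (simp add: summable_iff_shift)
      show "summable (\<lambda>k. real (Suc (k + n)) * h (k + n))"
        using h summable_iff_shift[of "\<lambda>t. real (Suc t) * h t" n] by blast
    qed (use h_nonneg in auto)
    also have "(\<Sum>t<n. real (Suc t) * h t) + \<dots> = (\<Sum>t. real (Suc t) * h t)"
      using suminf_split_initial_segment[OF h, of n] by simp
    finally show "(\<Sum>t<n. \<bar>c t - L\<bar>) \<le> (\<Sum>t. real (Suc t) * h t)" by simp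
  qed simp
  with L show ?thesis by (rule that)
qed

lemma summable_square_nonneg:
  fixes n :: "nat \<Rightarrow> real"
  assumes n: "summable n" and nonneg: "\<And>t. 0 \<le> n t"
  shows "summable (\<lambda>t. (n t)\<^sup>2)"
proof -
  have "n t \<le> suminf n" for t
    using sum_le_suminf[OF n, of "{t}"] nonneg by simp
  then show ?thesis
    using nonneg
    by (intro summable_comparison_test'[OF summable_mult[OF n, of "suminf n"], of 0])
      (auto simp: power2_eq_square intro!: mult_right_mono)
qed

text \<open>A sequence driven by steps \<open>a\<close> may diverge, but not faster than \<open>1 / a\<close>: as \<open>a\<close> is non-increasing,
\<open>a t * a s \<le> (a s)\<^sup>2\<close> for every earlier step \<open>s\<close>.\<close>
lemma step_times_drift_bounded:
  fixes S :: "nat \<Rightarrow> 'a::real_normed_vector"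
  assumes a: "decseq a" "\<And>t. 0 \<le> a t" "summable (\<lambda>t. (a t)\<^sup>2)"
    and n: "summable n" "\<And>t. 0 \<le> n t" and D: "0 \<le> D"
    and S: "\<And>t. norm (S (Suc t) - S t) \<le> n t + D * a t"
  shows "a t * norm (S t) \<le> a 0 * (norm (S 0) + suminf n) + D * (\<Sum>t. (a t)\<^sup>2)"
proof -
  have "norm (S t) \<le> norm (S 0) + (\<Sum>s<t. n s) + D * (\<Sum>s<t. a s)"
  proof (induction t)
    case (Suc t)
    then show ?case
      using S[of t] norm_triangle_sub[of "S (Suc t)" "S t"] by (simp add: algebra_simps)
  qed simp
  also have "(\<Sum>s<t. n s) \<le> suminf n" using n by (intro sum_le_suminf) auto
  finally have "a t * norm (S t) \<le> a t * (norm (S 0) + suminf n + D * (\<Sum>s<t. a s))"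
    using a(2) by (intro mult_left_mono) auto
  also have "\<dots> = a t * (norm (S 0) + suminf n) + D * (\<Sum>s<t. a t * a s)"
    by (simp add: algebra_simps sum_distrib_left)
  also have "\<dots> \<le> a 0 * (norm (S 0) + suminf n) + D * (\<Sum>t. (a t)\<^sup>2)"
  proof (intro add_mono mult_right_mono mult_left_mono D)
    show "a t \<le> a 0" using a(1) by (rule decseqD) simp
    show "0 \<le> norm (S 0) + suminf n" using n by (intro add_nonneg_nonneg suminf_nonneg) auto
    have "(\<Sum>s<t. a t * a s) \<le> (\<Sum>s<t. (a s)\<^sup>2)"
      using decseqD[OF a(1)] a(2) by (intro sum_mono) (auto simp: power2_eq_square intro: mult_right_mono)
    also have "\<dots> \<le> (\<Sum>t. (a t)\<^sup>2)" using a(3) by (intro sum_le_suminf) auto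
    finally show "(\<Sum>s<t. a t * a s) \<le> (\<Sum>t. (a t)\<^sup>2)" .
  qed
  finally show ?thesis .
qed

section \<open>Inexact gradient descent for a sum of convex functions\<close>

text \<open>The tangent inequality of one real variable, on the line through \<open>x\<close> and \<open>y\<close>.\<close>
lemma convex_on_gradient_below:
  fixes f :: "'a::euclidean_space \<Rightarrow> real"
  assumes convex: "convex_on UNIV f" and diff: "f differentiable at x"
  shows "f x + gradient f x \<bullet> (y - x) \<le> f y"
proof -
  define h where "h s = f (x + s *\<^sub>R (y - x))" for s :: real
  have "convex_on UNIV h"
  proof (rule convex_onI)
    fix t a b :: real
    assume "0 < t" "t < 1"
    have "x + ((1 - t) * a + t * b) *\<^sub>R (y - x)
        = (1 - t) *\<^sub>R (x + a *\<^sub>R (y - x)) + t *\<^sub>R (x + b *\<^sub>R (y - x))"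
      by (simp add: algebra_simps)
    then show "h ((1 - t) *\<^sub>R a + t *\<^sub>R b) \<le> (1 - t) * h a + t * h b"
      unfolding h_def using convex_onD[OF convex, of t] \<open>0 < t\<close> \<open>t < 1\<close> by simp
  qed simp
  moreover have "(h has_field_derivative gradient f x \<bullet> (y - x)) (at 0)"
  proof -
    have "(f has_derivative (\<lambda>v. v \<bullet> gradient f x)) (at (x + 0 *\<^sub>R (y - x)))"
      using GDERIV_gradient[OF diff] by (simp add: gderiv_def)
    moreover have "((\<lambda>s. x + s *\<^sub>R (y - x)) has_derivative (\<lambda>s. s *\<^sub>R (y - x))) (at 0)"
      by (auto intro!: derivative_eq_intros)
    ultimately have "(h has_derivative (\<lambda>s. (s *\<^sub>R (y - x)) \<bullet> gradient f x)) (at 0)"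
      unfolding h_def by (rule has_derivative_compose[rotated])
    then show ?thesis
      by (simp add: has_field_derivative_def inner_commute mult.commute[of "inner _ _"] mult_commute_abs)
  qed
  ultimately have "gradient f x \<bullet> (y - x) * (1 - 0) \<le> h 1 - h 0"
    by (intro convex_on_imp_above_tangent) auto
  then show ?thesis by (simp add: h_def)
qed

text \<open>Replacing \<open>u\<close> by \<open>z\<close> as the point where the gradient is taken costs \<open>D * norm (z - u)\<close> twice: once
because the direction should start at \<open>z\<close>, once because \<open>f\<close> is \<open>D\<close>-Lipschitz.\<close>
lemma inexact_gradient_inequality:
  fixes f :: "'a::euclidean_space \<Rightarrow> real"
  assumes convex: "convex_on UNIV f" and diff: "\<And>u. f differentiable at u"
    and bound: "\<And>u. norm (gradient f u) \<le> D"
  shows "f u - f v - 2 * D * norm (z - u) \<le> gradient f z \<bullet> (u - v)"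
proof -
  have "f z + gradient f z \<bullet> (v - z) \<le> f v" "f u + gradient f u \<bullet> (z - u) \<le> f z"
    using convex_on_gradient_below[OF convex diff] by blast+
  moreover have "\<bar>gradient f w \<bullet> (z - u)\<bar> \<le> D * norm (z - u)" for w
    using Cauchy_Schwarz_ineq2[of "gradient f w" "z - u"] mult_right_mono[OF bound[of w], of "norm (z - u)"]
    by simp
  from this[of u] this[of z]
  have "- (D * norm (z - u)) \<le> gradient f u \<bullet> (z - u)" "gradient f z \<bullet> (z - u) \<le> D * norm (z - u)"
    by auto
  ultimately show ?thesis by (simp add: inner_diff_right)
qed

text \<open>The squared distance to every minimizer is a quasi-Fejer sequence whose decrease term is the step
times the suboptimality of \<open>u t\<close>.  Hence all these distances converge, and since the steps are not
summable, the suboptimality is arbitrarily small infinitely often.  A cluster point of such a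
subsequence is a minimizer, and the distance to it can only converge to zero.\<close>
lemma perturbed_gradient_descent_converges:
  fixes f :: "'v::finite \<Rightarrow> 'a::euclidean_space \<Rightarrow> real"
    and u \<nu> :: "nat \<Rightarrow> 'a" and z :: "nat \<Rightarrow> 'v \<Rightarrow> 'a" and a :: "nat \<Rightarrow> real"
  defines "F \<equiv> \<lambda>u. \<Sum>i\<in>UNIV. f i u"
  assumes convex: "\<And>i. convex_on UNIV (f i)" and diff: "\<And>i u. f i differentiable at u"
    and bound: "\<And>i u. norm (gradient (f i) u) \<le> D"
    and min: "minimizers F \<noteq> {}"
    and u: "\<And>t. u (Suc t) = u t + \<nu> t - a t *\<^sub>R (\<Sum>i\<in>UNIV. gradient (f i) (z t i))"
    and a: "\<And>t. 0 \<le> a t" "\<not> summable a" "summable (\<lambda>t. (a t)\<^sup>2)"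
    and \<nu>: "summable (\<lambda>t. norm (\<nu> t))"
    and z: "\<And>i. summable (\<lambda>t. a t * norm (z t i - u t))"
  obtains v where "v \<in> minimizers F" and "u \<longlonglongrightarrow> v"
proof -
  define m where "m = real CARD('v)"
  define e where "e t = (\<Sum>i\<in>UNIV. norm (z t i - u t))" for t
  define d where "d t = norm (\<nu> t) + 2 * (norm (\<nu> t))\<^sup>2 + 2 * (m * D)\<^sup>2 * (a t)\<^sup>2 + 4 * D * (a t * e t)" for t
  have D: "0 \<le> D" using bound norm_ge_zero order_trans by blast
  have e: "0 \<le> e t" for t by (simp add: e_def sum_nonneg)
  have d_nonneg: "0 \<le> d t" for t using D e a(1)[of t] by (simp add: d_def)
  have "summable (\<lambda>t. a t * e t)"
    using z by (simp add: e_def sum_distrib_left summable_sum)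
  then have d: "summable d"
    unfolding d_def
    by (intro summable_add summable_mult \<nu> a(3) summable_square_nonneg[OF \<nu>] norm_ge_zero)
  have descent: "(norm (u (Suc t) - v))\<^sup>2
      \<le> (1 + norm (\<nu> t)) * (norm (u t - v))\<^sup>2 - 2 * (a t * (F (u t) - F v)) + d t" for t v
  proof -
    define G where "G = (\<Sum>i\<in>UNIV. gradient (f i) (z t i))"
    have G: "norm G \<le> m * D"
      unfolding G_def m_def by (rule sum_norm_bound) (rule bound)
    have "(\<Sum>i\<in>UNIV. f i (u t) - f i v - 2 * D * norm (z t i - u t))
        \<le> (\<Sum>i\<in>UNIV. gradient (f i) (z t i) \<bullet> (u t - v))"
      by (intro sum_mono inexact_gradient_inequality convex diff bound)
    then have "F (u t) - F v - 2 * D * e t \<le> G \<bullet> (u t - v)"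
      by (simp add: F_def e_def G_def inner_sum_left sum_subtractf sum_distrib_left)
    then have "a t * (F (u t) - F v - 2 * D * e t) \<le> a t * (G \<bullet> (u t - v))"
      using a(1) by (rule mult_left_mono)
    moreover have "(norm (\<nu> t - a t *\<^sub>R G))\<^sup>2 \<le> 2 * (norm (\<nu> t))\<^sup>2 + 2 * (m * D)\<^sup>2 * (a t)\<^sup>2"
    proof -
      have "norm (a t *\<^sub>R G) \<le> a t * (m * D)" using G a(1)[of t] by (simp add: mult_left_mono)
      then have "norm (\<nu> t - a t *\<^sub>R G) \<le> norm (\<nu> t) + a t * (m * D)"
        using norm_triangle_ineq4[of "\<nu> t" "a t *\<^sub>R G"] by linarith
      then have "(norm (\<nu> t - a t *\<^sub>R G))\<^sup>2 \<le> (norm (\<nu> t) + a t * (m * D))\<^sup>2"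
        by (rule power_mono) simp
      also have "\<dots> \<le> 2 * (norm (\<nu> t))\<^sup>2 + 2 * (a t * (m * D))\<^sup>2"
        using sum_squares_bound[of "norm (\<nu> t)" "a t * (m * D)"] by (simp add: power2_sum)
      finally show ?thesis by (simp add: power_mult_distrib mult_ac)
    qed
    \<comment> \<open>The disturbance enters linearly in \<open>norm (u t - v)\<close>; \<open>2 * r \<le> 1 + r\<^sup>2\<close> turns this into the
      multiplicative perturbation of the squared distance that the quasi-Fejer property admits.\<close>
    moreover have "2 * ((u t - v) \<bullet> \<nu> t) \<le> norm (\<nu> t) * (1 + (norm (u t - v))\<^sup>2)"
    proof -
      have "2 * ((u t - v) \<bullet> \<nu> t) \<le> norm (\<nu> t) * (2 * norm (u t - v))"
        using norm_cauchy_schwarz[of "u t - v" "\<nu> t"] by (simp add: mult_ac)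
      also have "\<dots> \<le> norm (\<nu> t) * (1 + (norm (u t - v))\<^sup>2)"
        using sum_squares_bound[of 1 "norm (u t - v)"] by (intro mult_left_mono) auto
      finally show ?thesis .
    qed
    moreover have "(norm (u (Suc t) - v))\<^sup>2
        = (norm (u t - v))\<^sup>2 + 2 * ((u t - v) \<bullet> \<nu> t) - 2 * (a t * (G \<bullet> (u t - v)))
          + (norm (\<nu> t - a t *\<^sub>R G))\<^sup>2"
    proof -
      have "u (Suc t) - v = (u t - v) + (\<nu> t - a t *\<^sub>R G)" by (simp add: u G_def)
      then show ?thesis
        by (simp only: power2_norm_eq_inner) (simp add: inner_commute algebra_simps)
    qed
    ultimately show ?thesis by (simp add: d_def algebra_simps)
  qed
  have F_ge: "F v \<le> F w" if "v \<in> minimizers F" for v w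
    using that by (auto simp: minimizers_def is_arg_min_linorder)
  have fejer: "convergent (\<lambda>t. (norm (u t - v))\<^sup>2)" "summable (\<lambda>t. 2 * (a t * (F (u t) - F v)))"
    if v: "v \<in> minimizers F" for v
  proof -
    have "0 \<le> 2 * (a t * (F (u t) - F v))" for t
      using F_ge[OF v, of "u t"] a(1)[of t] by simp
    from quasi_fejer_convergence[OF zero_le_power2 norm_ge_zero this d_nonneg descent \<nu> d]
    show "convergent (\<lambda>t. (norm (u t - v))\<^sup>2)" "summable (\<lambda>t. 2 * (a t * (F (u t) - F v)))" .
  qed
  obtain v where v: "v \<in> minimizers F" using min by blast
  have sum: "summable (\<lambda>t. a t * (F (u t) - F v))"
    using summable_mult[OF fejer(2)[OF v], of "1/2"] by simp
  have inf: "\<exists>t\<ge>N. F (u t) < F v + \<epsilon>" if "0 < \<epsilon>" for \<epsilon> N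
  proof (rule ccontr)
    assume "\<not> (\<exists>t\<ge>N. F (u t) < F v + \<epsilon>)"
    then have *: "\<epsilon> \<le> F (u t) - F v" if "t \<ge> N" for t using that by fastforce
    have "summable a"
    proof (rule summable_comparison_test'[OF summable_mult[OF sum, of "1/\<epsilon>"]])
      fix t assume "N \<le> t"
      then have "a t * \<epsilon> \<le> a t * (F (u t) - F v)" using * a(1) by (intro mult_left_mono)
      then show "norm (a t) \<le> 1 / \<epsilon> * (a t * (F (u t) - F v))"
        using a(1)[of t] that by (simp add: field_simps)
    qed
    with a(2) show False by simp
  qed
  have "\<exists>r. strict_mono r \<and> (\<forall>n. F (u (r n)) < F v + 1 / Suc n)"
  proof -
    have "\<exists>r. \<forall>n. F (u (r n)) < F v + 1 / Suc n \<and> r n < r (Suc n)"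
    proof (rule dependent_nat_choice)
      show "\<exists>k. F (u k) < F v + 1 / Suc 0" using inf[of 1 0] by auto
      show "\<exists>k'. F (u k') < F v + 1 / Suc (Suc n) \<and> k < k'" for k n
        using inf[of "1 / Suc (Suc n)" "Suc k"] by (auto simp: Suc_le_eq)
    qed
    then show ?thesis by (auto simp: strict_mono_Suc_iff)
  qed
  then obtain r where r: "strict_mono r" "\<And>n. F (u (r n)) < F v + 1 / Suc n" by blast
  have "Bseq (\<lambda>t. (norm (u t - v))\<^sup>2)"
    using fejer(1)[OF v] by (rule convergent_imp_Bseq)
  then obtain K where K: "\<And>t. (norm (u t - v))\<^sup>2 \<le> K"
    by (auto simp: Bseq_def)
  have "u t \<in> cball v (sqrt K)" for t
    using K[of t] by (simp add: dist_norm norm_minus_commute real_le_rsqrt)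
  then have "\<forall>n. (u \<circ> r) n \<in> cball v (sqrt K)" by (simp add: o_def)
  with compact_cball[of v "sqrt K"] obtain w s where s: "strict_mono s" "(u \<circ> r \<circ> s) \<longlonglongrightarrow> w"
    unfolding compact_eq_seq_compact_metric by (rule seq_compactE)
  have cont: "isCont F x" for x
    unfolding F_def using diff by (intro continuous_sum) (auto intro: differentiable_imp_continuous_within)
  have "(\<lambda>n. F ((u \<circ> r \<circ> s) n)) \<longlonglongrightarrow> F w"
    using cont s(2) by (rule isCont_tendsto_compose)
  moreover have "(\<lambda>n. F v + 1 / Suc (s n)) \<longlonglongrightarrow> F v + 0"
    using LIMSEQ_subseq_LIMSEQ[OF lim_1_over_n[THEN LIMSEQ_Suc] s(1)]
    by (intro tendsto_intros) (simp add: o_def)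
  ultimately have "F w \<le> F v + 0"
    using r(2) by (intro LIMSEQ_le) (auto intro: less_imp_le)
  then have "F w \<le> F x" for x using F_ge[OF v, of x] by simp
  then have w: "w \<in> minimizers F" by (simp add: minimizers_def is_arg_min_linorder)
  obtain L where L: "(\<lambda>t. (norm (u t - w))\<^sup>2) \<longlonglongrightarrow> L"
    using fejer(1)[OF w] by (auto simp: convergent_def)
  have "(\<lambda>n. (norm ((u \<circ> r \<circ> s) n - w))\<^sup>2) \<longlonglongrightarrow> (norm (w - w))\<^sup>2"
    by (intro tendsto_intros s(2))
  moreover have "(\<lambda>n. (norm ((u \<circ> r \<circ> s) n - w))\<^sup>2) \<longlonglongrightarrow> L"
    using LIMSEQ_subseq_LIMSEQ[OF L strict_mono_o[OF r(1) s(1)]] by (simp add: o_def)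
  ultimately have "L = (norm (w - w))\<^sup>2" by (rule LIMSEQ_unique[rotated])
  then have "L = 0" by simp
  then have "(\<lambda>t. sqrt ((norm (u t - w))\<^sup>2)) \<longlonglongrightarrow> sqrt 0"
    using L by (intro tendsto_real_sqrt) simp
  then have "u \<longlonglongrightarrow> w" by (simp add: LIM_zero_iff tendsto_norm_zero_iff)
  with w show ?thesis by (rule that)
qed

section \<open>One push step\<close>

definition push_step ::
  "('v::finite \<times> 'v) set \<Rightarrow> ('v \<Rightarrow> 'b::real_normed_vector) \<Rightarrow> 'v \<Rightarrow> 'b" where
  "push_step E p i = (\<Sum>j\<in>UNIV. push_matrix E $ i $ j *\<^sub>R p j)"

lemma out_degree_pos: "0 < out_degree E (j::'v::finite)"
  by (auto simp: out_degree_def out_nbrs_def card_gt_0_iff)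

lemma push_matrix_nonneg: "0 \<le> push_matrix E $ i $ j"
  by (simp add: push_matrix_def)

lemma push_matrix_lower:
  fixes i j :: "'v::finite"
  assumes "i = j \<or> (j, i) \<in> E"
  shows "1 / real CARD('v) \<le> push_matrix E $ i $ j"
proof -
  have "out_degree E j \<le> CARD('v)" by (simp add: out_degree_def card_mono)
  with assms out_degree_pos[of E j] show ?thesis
    by (auto simp: push_matrix_def in_nbrs_def intro!: divide_left_mono)
qed

lemma push_matrix_column_sum: "(\<Sum>i\<in>UNIV. push_matrix E $ i $ j) = 1"
proof -
  have "(\<Sum>i\<in>UNIV. push_matrix E $ i $ j) = (\<Sum>i\<in>out_nbrs E j. 1 / real (out_degree E j))"
    by (rule sum.mono_neutral_cong_right) (auto simp: push_matrix_def in_nbrs_def out_nbrs_def)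
  then show ?thesis using out_degree_pos[of E j] by (auto simp: out_degree_def)
qed

lemma sum_push_step: "(\<Sum>i\<in>UNIV. push_step E p i) = (\<Sum>i\<in>UNIV. p i)"
  unfolding push_step_def
  by (subst sum.swap) (simp add: scaleR_left.sum[symmetric] push_matrix_column_sum)

text \<open>Column sums are one and entries nonnegative, so mass can cancel but not grow.\<close>
lemma push_step_l1_nonexpansive: "(\<Sum>i\<in>UNIV. norm (push_step E p i)) \<le> (\<Sum>i\<in>UNIV. norm (p i))"
proof -
  have "(\<Sum>i\<in>UNIV. norm (push_step E p i)) \<le> (\<Sum>i\<in>UNIV. push_step E (\<lambda>j. norm (p j)) i)"
    unfolding push_step_def
    by (intro sum_mono order_trans[OF norm_sum]) (simp add: push_matrix_nonneg)
  then show ?thesis by (simp add: sum_push_step)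
qed

lemma push_step_diff: "push_step E (\<lambda>j. p j - q j) i = push_step E p i - push_step E q i"
  by (simp add: push_step_def scaleR_diff_right sum_subtractf)

lemma push_step_scaleR: "push_step E (\<lambda>j. c j *\<^sub>R v) i = push_step E c i *\<^sub>R v"
  by (simp add: push_step_def scaleR_left.sum)

lemma push_step_sum: "push_step E (\<lambda>j. \<Sum>k\<in>K. p k j) i = (\<Sum>k\<in>K. push_step E (p k) i)"
  unfolding push_step_def by (simp add: scaleR_sum_right) (rule sum.swap)

lemma push_step_nonneg:
  fixes p :: "'v::finite \<Rightarrow> real"
  shows "(\<And>j. 0 \<le> p j) \<Longrightarrow> 0 \<le> push_step E p i"
  by (simp add: push_step_def push_matrix_nonneg sum_nonneg)

lemma push_step_lower:
  fixes p :: "'v::finite \<Rightarrow> real"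
  assumes "\<And>j. 0 \<le> p j" and "i = j \<or> (j, i) \<in> E"
  shows "p j / real CARD('v) \<le> push_step E p i"
proof -
  have "p j / real CARD('v) \<le> push_matrix E $ i $ j *\<^sub>R p j"
    using mult_right_mono[OF push_matrix_lower[OF assms(2)] assms(1)] by simp
  also have "\<dots> \<le> push_step E p i"
    unfolding push_step_def
    by (rule member_le_sum) (auto simp: assms push_matrix_nonneg)
  finally show ?thesis .
qed

section \<open>Mixing over a window\<close>

primrec push_iter ::
  "(nat \<Rightarrow> ('v::finite \<times> 'v) set) \<Rightarrow> nat \<Rightarrow> nat \<Rightarrow>
   ('v \<Rightarrow> 'b::real_normed_vector) \<Rightarrow> 'v \<Rightarrow> 'b" where
  "push_iter E s 0 p = p"
| "push_iter E s (Suc n) p = push_step (E (s + n)) (push_iter E s n p)"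

lemma push_iter_add: "push_iter E s (n + k) p = push_iter E (s + n) k (push_iter E s n p)"
  by (induction k) (auto simp: add.assoc)

lemma sum_push_iter: "(\<Sum>i\<in>UNIV. push_iter E s n p i) = (\<Sum>i\<in>UNIV. p i)"
  by (induction n) (simp_all add: sum_push_step)

lemma push_iter_nonneg:
  fixes p :: "'v::finite \<Rightarrow> real"
  shows "(\<And>j. 0 \<le> p j) \<Longrightarrow> 0 \<le> push_iter E s n p i"
  by (induction n arbitrary: i) (simp_all add: push_step_nonneg)

definition unit_mass :: "'v \<Rightarrow> 'v \<Rightarrow> real" where
  "unit_mass j k = of_bool (j = k)"

lemma unit_mass_nonneg: "0 \<le> unit_mass j k"
  by (simp add: unit_mass_def)

lemma sum_unit_mass: "(\<Sum>k\<in>UNIV. unit_mass (j::'v::finite) k) = 1"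
  by (simp add: unit_mass_def of_bool_def)

text \<open>The iterates of the unit masses are the columns of the product of the push matrices; they are real
even when \<open>p\<close> takes values in a normed space.\<close>
lemma push_iter_entries:
  "push_iter E s n p i = (\<Sum>j\<in>UNIV. push_iter E s n (unit_mass j) i *\<^sub>R p j)"
proof (induction n arbitrary: i)
  case 0
  have "(\<Sum>j\<in>UNIV. unit_mass j i *\<^sub>R p j) = (\<Sum>j\<in>UNIV. if j = i then p j else 0)"
    by (intro sum.cong) (auto simp: unit_mass_def)
  then show ?case by simp
next
  case (Suc n)
  have "push_iter E s (Suc n) p i = push_step (E (s + n)) (push_iter E s n p) i" by simp
  also have "push_iter E s n p = (\<lambda>k. \<Sum>j\<in>UNIV. push_iter E s n (unit_mass j) k *\<^sub>R p j)"
    using Suc by blast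
  also have "push_step (E (s + n)) \<dots> i
      = (\<Sum>j\<in>UNIV. push_iter E s (Suc n) (unit_mass j) i *\<^sub>R p j)"
    by (simp add: push_step_sum push_step_scaleR)
  finally show ?case .
qed

text \<open>A path from \<open>a\<close> to \<open>b\<close> must leave \<open>R\<close> somewhere.\<close>
lemma strongly_connected_leaving_edge:
  assumes sc: "strongly_connected (with_proj \<lparr> pverts = UNIV, parcs = A \<rparr>)"
    and "a \<in> R" and "b \<notin> R"
  obtains u v where "(u, v) \<in> A" "u \<in> R" "v \<notin> R"
proof -
  let ?G = "with_proj \<lparr> pverts = UNIV, parcs = A \<rparr>"
  have "a \<rightarrow>\<^sup>*\<^bsub>?G\<^esub> b" using sc by (auto simp: strongly_connected_def)
  then have "(a, b) \<in> (arcs_ends ?G)\<^sup>*"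
    unfolding reachable_def by (rule rtrancl_on_rtranclI)
  moreover have "arcs_ends ?G = A" by (auto simp: arcs_ends_def arc_to_ends_def)
  ultimately have "(a, b) \<in> A\<^sup>*" by simp
  then have "b \<in> R \<or> (\<exists>u v. (u, v) \<in> A \<and> u \<in> R \<and> v \<notin> R)"
    using assms(2) by induction blast+
  with assms(3) that show thesis by blast
qed

lemma push_iter_pos_mono:
  fixes p :: "'v::finite \<Rightarrow> real"
  assumes p: "\<And>j. 0 \<le> p j" and "0 < push_iter E s n p i" and "n \<le> k"
  shows "0 < push_iter E s k p i"
  using assms(3,2)
proof (induction rule: dec_induct)
  case (step k)
  have "push_iter E s k p i / real CARD('v) \<le> push_iter E s (Suc k) p i"
    using push_iter_nonneg[of p E s k] p by (simp add: push_step_lower)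
  with step show ?case by (metis divide_pos_pos less_le_trans of_nat_0_less_iff zero_less_card_finite)
qed

text \<open>Every nonzero entry of a push matrix is at least \<open>1 / m\<close>, so a positive entry of a product of \<open>n\<close>
of them, being at least one product of nonzero entries, cannot be smaller than \<open>(1 / m) ^ n\<close>.\<close>
lemma push_iter_pos_bound:
  fixes j :: "'v::finite"
  assumes "0 < push_iter E s n (unit_mass j) i"
  shows "(1 / real CARD('v)) ^ n \<le> push_iter E s n (unit_mass j) i"
  using assms
proof (induction n arbitrary: i)
  case 0
  then show ?case by (auto simp: unit_mass_def of_bool_def split: if_splits)
next
  case (Suc n)
  let ?p = "push_iter E s n (unit_mass j)"
  have nonneg: "0 \<le> ?p k" for k by (rule push_iter_nonneg) (rule unit_mass_nonneg)
  from Suc.prems obtain k where k: "0 < push_matrix (E (s + n)) $ i $ k * ?p k"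
    unfolding push_iter.simps push_step_def
    by (metis (no_types, lifting) linorder_not_less real_scaleR_def sum_nonpos)
  then have "0 < ?p k" "push_matrix (E (s + n)) $ i $ k \<noteq> 0"
    using nonneg[of k] by (auto simp: zero_less_mult_iff)
  then have "i = k \<or> (k, i) \<in> E (s + n)" 
    by (auto simp: push_matrix_def in_nbrs_def split: if_splits)
  from push_step_lower[of ?p, OF nonneg this] have "?p k / real CARD('v) \<le> push_iter E s (Suc n) (unit_mass j) i"
    by simp
  moreover have "(1 / real CARD('v)) ^ Suc n \<le> ?p k / real CARD('v)"
    using divide_right_mono[OF Suc.IH[OF \<open>0 < ?p k\<close>], of "real CARD('v)"] by simp
  ultimately show ?case by linarith
qed

text \<open>The numbers \<open>push_iter E s W (unit_mass j) i\<close> are the entries of the product of the push matrices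
at the times from \<open>s\<close> to \<open>s + W - 1\<close>.\<close>
definition uniformly_mixing ::
  "(nat \<Rightarrow> ('v::finite \<times> 'v) set) \<Rightarrow> nat \<Rightarrow> real \<Rightarrow> bool" where
  "uniformly_mixing E W \<eta> \<longleftrightarrow> 0 < \<eta> \<and> (\<forall>s i j. \<eta> \<le> push_iter E s W (unit_mass j) i)"

lemma uniformly_mixing_pos: "uniformly_mixing E W \<eta> \<Longrightarrow> 0 < \<eta>"
  by (simp add: uniformly_mixing_def)

lemma uniformly_mixing_lower:
  "uniformly_mixing E W \<eta> \<Longrightarrow> \<eta> \<le> push_iter E s W (unit_mass j) i"
  by (simp add: uniformly_mixing_def)

lemma uniformly_mixing_le_1:
  fixes E :: "nat \<Rightarrow> ('v::finite \<times> 'v) set"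
  assumes "uniformly_mixing E W \<eta>"
  shows "real CARD('v) * \<eta> \<le> 1"
proof -
  have "(\<Sum>i\<in>(UNIV::'v set). \<eta>) \<le> (\<Sum>i\<in>UNIV. push_iter E 0 W (unit_mass undefined) i)"
    by (intro sum_mono uniformly_mixing_lower assms)
  then show ?thesis by (simp add: sum_push_iter sum_unit_mass)
qed

text \<open>The set of agents reached by the mass of agent \<open>j\<close> never shrinks, because agents keep a share, and
grows whenever a full connectivity block passes.  A window of length \<open>2 * B\<close> contains such a block
wherever it starts, so \<open>m\<close> windows of this length suffice.\<close>
lemma uniformly_strongly_connected_mixing:
  fixes E :: "nat \<Rightarrow> ('v::finite \<times> 'v) set"
  assumes "uniformly_strongly_connected E"
  obtains W \<eta> where "uniformly_mixing E W \<eta>"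
proof -
  from assms obtain B where "0 < B"
    and sc: "\<And>k. strongly_connected
        (with_proj \<lparr> pverts = UNIV, parcs = (\<Union>t\<in>{k * B..<(k + 1) * B}. E t) \<rparr>)"
    unfolding uniformly_strongly_connected_def by blast
  have "0 < push_iter E s (2 * B * CARD('v)) (unit_mass j) i" for s i j
  proof -
    define R where "R n = {i. 0 < push_iter E s n (unit_mass j) i}" for n
    have nonneg: "0 \<le> push_iter E s n (unit_mass j) k" for n k
      by (rule push_iter_nonneg) (rule unit_mass_nonneg)
    have mono: "R n \<subseteq> R k" if "n \<le> k" for n k
      unfolding R_def using that by (auto intro: push_iter_pos_mono unit_mass_nonneg)
    have start: "j \<in> R 0" by (simp add: R_def unit_mass_def)
    have grow: "card (R n) < card (R (n + 2 * B))" if n: "R n \<noteq> UNIV" for n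
    proof -
      define k where "k = (s + n) div B + 1"
      have kB: "s + n \<le> k * B" "(k + 1) * B \<le> s + n + 2 * B"
        using dividend_less_div_times[OF \<open>0 < B\<close>, of "s + n"] div_times_less_eq_dividend[of "s + n" B]
        by (simp_all add: k_def)
      from n obtain b where "b \<notin> R n" by blast
      moreover have "j \<in> R n" using start mono by blast
      ultimately obtain u v where uv: "(u, v) \<in> (\<Union>t\<in>{k * B..<(k + 1) * B}. E t)" "u \<in> R n" "v \<notin> R n"
        using strongly_connected_leaving_edge[OF sc] by metis
      then obtain t where t: "k * B \<le> t" "t < (k + 1) * B" "(u, v) \<in> E t" by auto
      define l where "l = t - s"
      have l: "n \<le> l" "Suc l \<le> n + 2 * B" "E (s + l) = E t" using t kB by (auto simp: l_def)
      have "u \<in> R l" using uv(2) mono[OF l(1)] by blast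
      then have "0 < push_iter E s l (unit_mass j) u / real CARD('v)"
        by (simp add: R_def)
      also have "\<dots> \<le> push_iter E s (Suc l) (unit_mass j) v"
        using nonneg t(3) l(3) by (auto intro!: push_step_lower)
      finally have "v \<in> R (Suc l)" by (simp add: R_def)
      then have "v \<in> R (n + 2 * B)" using mono[OF l(2)] by blast
      then have "R n \<subset> R (n + 2 * B)" using uv(3) mono[of n "n + 2 * B"] by auto
      then show ?thesis by (intro psubset_card_mono) auto
    qed
    have "min (Suc n) CARD('v) \<le> card (R (2 * B * n))" for n
    proof (induction n)
      case 0
      have "0 < card (R 0)" using start by (auto simp: card_gt_0_iff)
      then show ?case by simp
    next
      case (Suc n)
      show ?case
      proof (cases "R (2 * B * n) = UNIV")
        case True
        then have "R (2 * B * Suc n) = UNIV" using mono[of "2 * B * n" "2 * B * Suc n"] by auto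
        then show ?thesis by simp
      next
        case False
        from grow[OF this] Suc show ?thesis by (simp add: add.commute)
      qed
    qed
    from this[of "CARD('v)"] have "CARD('v) \<le> card (R (2 * B * CARD('v)))" by simp
    then have "R (2 * B * CARD('v)) = UNIV" by (intro card_seteq) auto
    then show ?thesis by (auto simp: R_def)
  qed
  then have "uniformly_mixing E (2 * B * CARD('v)) ((1 / real CARD('v)) ^ (2 * B * CARD('v)))"
    unfolding uniformly_mixing_def by (auto intro: push_iter_pos_bound)
  then show thesis by (rule that)
qed

text \<open>On a vector of total zero, subtracting \<open>\<eta>\<close> from all entries of the matrix changes nothing, and the
remaining matrix is still nonnegative, with column sums \<open>1 - m * \<eta>\<close>.\<close>
lemma push_iter_zero_sum_contraction:
  fixes E :: "nat \<Rightarrow> ('v::finite \<times> 'v) set" and v :: "'v \<Rightarrow> 'b::real_normed_vector"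
  assumes mixing: "uniformly_mixing E W \<eta>"
    and zero: "(\<Sum>j\<in>UNIV. v j) = 0"
  shows "(\<Sum>i\<in>UNIV. norm (push_iter E s W v i)) \<le> (1 - real CARD('v) * \<eta>) * (\<Sum>j\<in>UNIV. norm (v j))"
proof -
  let ?P = "\<lambda>i j. push_iter E s W (unit_mass j) i"
  have col: "(\<Sum>i\<in>UNIV. ?P i j) = 1" for j
    by (simp add: sum_push_iter sum_unit_mass)
  have "norm (push_iter E s W v i) \<le> (\<Sum>j\<in>UNIV. (?P i j - \<eta>) * norm (v j))" for i
  proof -
    have "push_iter E s W v i = (\<Sum>j\<in>UNIV. ?P i j *\<^sub>R v j) - \<eta> *\<^sub>R (\<Sum>j\<in>UNIV. v j)"
      by (subst push_iter_entries) (simp add: zero)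
    also have "\<dots> = (\<Sum>j\<in>UNIV. (?P i j - \<eta>) *\<^sub>R v j)"
      by (simp add: scaleR_sum_right sum_subtractf scaleR_diff_left)
    finally show ?thesis
      using uniformly_mixing_lower[OF mixing] by (auto intro!: order_trans[OF norm_sum] sum_mono)
  qed
  then have "(\<Sum>i\<in>UNIV. norm (push_iter E s W v i)) \<le> (\<Sum>i\<in>UNIV. \<Sum>j\<in>UNIV. (?P i j - \<eta>) * norm (v j))"
    by (rule sum_mono)
  also have "\<dots> = (\<Sum>j\<in>UNIV. \<Sum>i\<in>UNIV. (?P i j - \<eta>) * norm (v j))"
    by (rule sum.swap)
  also have "\<dots> = (1 - real CARD('v) * \<eta>) * (\<Sum>j\<in>UNIV. norm (v j))"
    by (simp only: sum_distrib_right[symmetric] sum_subtractf col sum_constant sum_distrib_left)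
  finally show ?thesis .
qed

section \<open>Distance to consensus\<close>

text \<open>The unperturbed iterate of the uniform distribution: the shape that the iterates of any vector
approach, up to the factor given by its total.\<close>
definition push_weight ::
  "(nat \<Rightarrow> ('v::finite \<times> 'v) set) \<Rightarrow> nat \<Rightarrow> 'v \<Rightarrow> real" where
  "push_weight E t = push_iter E 0 t (\<lambda>_. 1 / real CARD('v))"

lemma push_weight_Suc: "push_weight E (Suc t) = push_step (E t) (push_weight E t)"
  by (simp add: push_weight_def)

lemma push_weight_nonneg: "0 \<le> push_weight E t i"
  unfolding push_weight_def by (rule push_iter_nonneg) simp

lemma push_weight_sum: "(\<Sum>i\<in>UNIV. push_weight E t i) = 1"
  by (simp add: push_weight_def sum_push_iter)

lemma push_weight_le_1: "push_weight E t i \<le> 1"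
  using member_le_sum[of i UNIV "push_weight E t"] by (simp add: push_weight_sum push_weight_nonneg)

lemma push_weight_lower:
  fixes E :: "nat \<Rightarrow> ('v::finite \<times> 'v) set"
  assumes mixing: "uniformly_mixing E W \<eta>" and "W \<le> t"
  shows "\<eta> \<le> push_weight E t i"
proof -
  have "push_weight E t = push_iter E (t - W) W (push_weight E (t - W))"
    using push_iter_add[of E 0 "t - W" W] \<open>W \<le> t\<close> by (simp add: push_weight_def)
  then have "push_weight E t i = (\<Sum>j\<in>UNIV. push_iter E (t - W) W (unit_mass j) i * push_weight E (t - W) j)"
    by (simp add: push_iter_entries[of E "t - W" W "push_weight E (t - W)"])
  also have "\<dots> \<ge> (\<Sum>j\<in>UNIV. \<eta> * push_weight E (t - W) j)"
    by (intro sum_mono mult_right_mono uniformly_mixing_lower mixing push_weight_nonneg)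
  also have "(\<Sum>j\<in>UNIV. \<eta> * push_weight E (t - W) j) = \<eta>"
    by (simp add: sum_distrib_left[symmetric] push_weight_sum)
  finally show ?thesis .
qed

definition deviation ::
  "(nat \<Rightarrow> ('v::finite \<times> 'v) set) \<Rightarrow>
   (nat \<Rightarrow> 'v \<Rightarrow> 'b::real_normed_vector) \<Rightarrow> nat \<Rightarrow> 'v \<Rightarrow> 'b" where
  "deviation E p t i = p t i - push_weight E t i *\<^sub>R (\<Sum>j\<in>UNIV. p t j)"

definition spread ::
  "(nat \<Rightarrow> ('v::finite \<times> 'v) set) \<Rightarrow>
   (nat \<Rightarrow> 'v \<Rightarrow> 'b::real_normed_vector) \<Rightarrow> nat \<Rightarrow> real" where
  "spread E p t = (\<Sum>i\<in>UNIV. norm (deviation E p t i))"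

lemma spread_nonneg: "0 \<le> spread E p t"
  by (simp add: spread_def sum_nonneg)

lemma sum_deviation: "(\<Sum>i\<in>UNIV. deviation E p t i) = 0"
  by (simp add: deviation_def sum_subtractf scaleR_left.sum[symmetric] push_weight_sum)

lemma push_step_deviation:
  "push_step (E t) (deviation E p t) i
    = push_step (E t) (p t) i - push_weight E (Suc t) i *\<^sub>R (\<Sum>j\<in>UNIV. p t j)"
  unfolding deviation_def[abs_def] by (simp add: push_step_diff push_step_scaleR push_weight_Suc)

text \<open>One push step maps \<open>push_weight E t\<close> to \<open>push_weight E (Suc t)\<close> and does not increase the spread; this
is what the algorithm divides, since \<open>wh\<close> and \<open>y\<close> are push steps of the broadcast values.\<close>
lemma push_step_near_weight:
  "norm (push_step (E t) (p t) i - push_weight E (Suc t) i *\<^sub>R (\<Sum>j\<in>UNIV. p t j)) \<le> spread E p t"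
proof -
  have "norm (push_step (E t) (deviation E p t) i) \<le> (\<Sum>i\<in>UNIV. norm (push_step (E t) (deviation E p t) i))"
    by (rule member_le_sum) auto
  also have "\<dots> \<le> spread E p t"
    unfolding spread_def by (rule push_step_l1_nonexpansive)
  finally show ?thesis by (simp add: push_step_deviation)
qed

text \<open>The error of one step is counted twice: directly, and through its effect on the total.\<close>
lemma deviation_step_error:
  "(\<Sum>i\<in>UNIV. norm (deviation E p (Suc t) i - push_step (E t) (deviation E p t) i))
    \<le> 2 * (\<Sum>i\<in>UNIV. norm (p (Suc t) i - push_step (E t) (p t) i))"
proof -
  define r where "r i = p (Suc t) i - push_step (E t) (p t) i" for i
  have "(\<Sum>j\<in>UNIV. r j) = (\<Sum>j\<in>UNIV. p (Suc t) j) - (\<Sum>j\<in>UNIV. p t j)"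
    by (simp add: r_def sum_subtractf sum_push_step)
  then have "deviation E p (Suc t) i - push_step (E t) (deviation E p t) i
      = r i - push_weight E (Suc t) i *\<^sub>R (\<Sum>j\<in>UNIV. r j)" for i
    by (simp add: push_step_deviation) (simp add: deviation_def r_def scaleR_diff_right)
  moreover have "norm (r i - push_weight E (Suc t) i *\<^sub>R (\<Sum>j\<in>UNIV. r j))
      \<le> norm (r i) + push_weight E (Suc t) i * (\<Sum>j\<in>UNIV. norm (r j))" for i
    using mult_left_mono[OF norm_sum[of r UNIV] push_weight_nonneg[of E "Suc t" i]]
    by (intro order_trans[OF norm_triangle_ineq4]) (simp add: push_weight_nonneg)
  ultimately have "(\<Sum>i\<in>UNIV. norm (deviation E p (Suc t) i - push_step (E t) (deviation E p t) i))
      \<le> (\<Sum>i\<in>UNIV. norm (r i) + push_weight E (Suc t) i * (\<Sum>j\<in>UNIV. norm (r j)))"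
    by (simp add: sum_mono)
  also have "\<dots> = 2 * (\<Sum>i\<in>UNIV. norm (r i))"
    by (simp add: sum.distrib sum_distrib_right[symmetric] push_weight_sum)
  finally show ?thesis by (simp add: r_def)
qed

text \<open>Over the window the deviation follows the unperturbed iteration, which contracts because its total
is zero, up to at most \<open>W\<close> step errors; none of them is amplified later.  As \<open>h\<close> is non-increasing,
its value at the start of the window bounds them all.\<close>
lemma spread_contraction:
  fixes p :: "nat \<Rightarrow> 'v::finite \<Rightarrow> 'b::real_normed_vector"
  assumes mixing: "uniformly_mixing E W \<eta>"
    and error: "\<And>t. (\<Sum>i\<in>UNIV. norm (p (Suc t) i - push_step (E t) (p t) i)) \<le> h t"
    and h: "decseq h"
  shows "spread E p (t + W) \<le> (1 - real CARD('v) * \<eta>) * spread E p t + 2 * real W * h t"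
proof -
  have drift: "(\<Sum>i\<in>UNIV. norm (deviation E p (t + n) i - push_iter E t n (deviation E p t) i))
      \<le> real n * (2 * h t)" for n
  proof (induction n)
    case (Suc n)
    let ?d = "\<lambda>i. deviation E p (t + n) i - push_iter E t n (deviation E p t) i"
    have "(\<Sum>i\<in>UNIV. norm (deviation E p (t + Suc n) i - push_iter E t (Suc n) (deviation E p t) i))
        \<le> (\<Sum>i\<in>UNIV. norm (deviation E p (Suc (t + n)) i - push_step (E (t + n)) (deviation E p (t + n)) i)
            + norm (push_step (E (t + n)) ?d i))"
    proof (rule sum_mono)
      fix i
      have "deviation E p (t + Suc n) i - push_iter E t (Suc n) (deviation E p t) i
        = (deviation E p (Suc (t + n)) i - push_step (E (t + n)) (deviation E p (t + n)) i)
          + push_step (E (t + n)) ?d i"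
        by (simp add: push_step_diff)
      then show "norm (deviation E p (t + Suc n) i - push_iter E t (Suc n) (deviation E p t) i)
        \<le> norm (deviation E p (Suc (t + n)) i - push_step (E (t + n)) (deviation E p (t + n)) i)
            + norm (push_step (E (t + n)) ?d i)"
        by (simp only: norm_triangle_ineq)
    qed
    also have "\<dots> \<le> 2 * h (t + n) + real n * (2 * h t)"
      unfolding sum.distrib
    proof (rule add_mono)
      show "(\<Sum>i\<in>UNIV. norm (deviation E p (Suc (t + n)) i - push_step (E (t + n)) (deviation E p (t + n)) i))
          \<le> 2 * h (t + n)"
        using deviation_step_error[of E p "t + n"] error[of "t + n"] by linarith
      show "(\<Sum>i\<in>UNIV. norm (push_step (E (t + n)) ?d i)) \<le> real n * (2 * h t)"
        using push_step_l1_nonexpansive Suc.IH by (rule order_trans)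
    qed
    also have "h (t + n) \<le> h t" using h by (rule decseqD) simp
    finally show ?case by (simp add: algebra_simps)
  qed simp
  have "spread E p (t + W) \<le> (\<Sum>i\<in>UNIV. norm (push_iter E t W (deviation E p t) i)
      + norm (deviation E p (t + W) i - push_iter E t W (deviation E p t) i))"
    unfolding spread_def by (intro sum_mono norm_triangle_sub)
  also have "\<dots> \<le> (1 - real CARD('v) * \<eta>) * spread E p t + real W * (2 * h t)"
    unfolding sum.distrib
    using push_iter_zero_sum_contraction[OF mixing sum_deviation] drift
    by (intro add_mono) (auto simp: spread_def)
  finally show ?thesis by simp
qed

lemma total_increment:
  fixes p :: "nat \<Rightarrow> 'v::finite \<Rightarrow> 'b::real_normed_vector"
  assumes "(\<Sum>i\<in>UNIV. norm (p (Suc t) i - push_step (E t) (p t) i)) \<le> e"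
  shows "norm ((\<Sum>i\<in>UNIV. p (Suc t) i) - (\<Sum>i\<in>UNIV. p t i)) \<le> e"
proof -
  have "(\<Sum>i\<in>UNIV. p (Suc t) i) - (\<Sum>i\<in>UNIV. p t i) = (\<Sum>i\<in>UNIV. p (Suc t) i - push_step (E t) (p t) i)"
    by (simp add: sum_subtractf sum_push_step)
  with assms show ?thesis using norm_sum order_trans by metis
qed

text \<open>A non-increasing weight \<open>a\<close> may be pulled back to the start of each window, so the weighted spread
obeys the same contraction.\<close>
lemma spread_weighted_summable:
  fixes p :: "nat \<Rightarrow> 'v::finite \<Rightarrow> 'b::real_normed_vector"
  assumes mixing: "uniformly_mixing E W \<eta>"
    and error: "\<And>t. (\<Sum>i\<in>UNIV. norm (p (Suc t) i - push_step (E t) (p t) i)) \<le> h t"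
    and h: "decseq h" and a: "decseq a" "\<And>t. 0 \<le> a t"
    and sum: "summable (\<lambda>t. a t * h t)"
  shows "summable (\<lambda>t. a t * spread E p t)"
proof (rule summable_delayed_contraction)
  show "summable (\<lambda>t. 2 * real W * (a t * h t))" using sum by (rule summable_mult)
  have h0: "0 \<le> h t" for t
    using error[of t] by (rule order_trans[rotated]) (simp add: sum_nonneg)
  then show "0 \<le> 2 * real W * (a t * h t)" for t using a(2) by simp
  show "0 \<le> a t * spread E p t" for t using a(2) by (simp add: spread_nonneg)
  show "0 < real CARD('v) * \<eta>" using uniformly_mixing_pos[OF mixing] by simp
  fix t
  have "a (t + W) * spread E p (t + W) \<le> a t * spread E p (t + W)"
    using decseqD[OF a(1), of t "t + W"] by (intro mult_right_mono) (auto simp: spread_nonneg)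
  also have "\<dots> \<le> a t * ((1 - real CARD('v) * \<eta>) * spread E p t + 2 * real W * h t)"
    by (intro mult_left_mono spread_contraction mixing error h a)
  finally show "a (t + W) * spread E p (t + W)
      \<le> (1 - real CARD('v) * \<eta>) * (a t * spread E p t) + 2 * real W * (a t * h t)"
    by (simp add: algebra_simps)
qed

lemma spread_tendsto_zero:
  fixes p :: "nat \<Rightarrow> 'v::finite \<Rightarrow> 'b::real_normed_vector"
  assumes mixing: "uniformly_mixing E W \<eta>"
    and error: "\<And>t. (\<Sum>i\<in>UNIV. norm (p (Suc t) i - push_step (E t) (p t) i)) \<le> h t"
    and h: "decseq h" "h \<longlonglongrightarrow> 0"
  shows "spread E p \<longlonglongrightarrow> 0"
proof (rule tendsto_zero_delayed_contraction)
  show "0 < real CARD('v) * \<eta>" using uniformly_mixing_pos[OF mixing] by simp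
  show "real CARD('v) * \<eta> \<le> 1" using mixing by (rule uniformly_mixing_le_1)
  show "spread E p (t + W) \<le> (1 - real CARD('v) * \<eta>) * spread E p t + 2 * real W * h t" for t
    by (intro spread_contraction mixing error h)
  show "(\<lambda>t. 2 * real W * h t) \<longlonglongrightarrow> 0"
    using tendsto_mult_right_zero[OF h(2)] by simp
qed (rule spread_nonneg)

section \<open>Event-triggered gradient push\<close>

text \<open>If numerator and denominator are nearly the same multiple \<open>w\<close> of \<open>S\<close> and \<open>c\<close>, the multiple cancels.
The error of the denominator is amplified by the size of \<open>S\<close>.\<close>
lemma ratio_of_near_multiples:
  fixes x S :: "'a::real_normed_vector"
  assumes "0 < \<beta>" "\<beta> \<le> y" "0 < c"
  shows "norm (x /\<^sub>R y - S /\<^sub>R c) \<le> (norm (x - w *\<^sub>R S) + \<bar>y - w * c\<bar> * norm S / c) / \<beta>"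
proof -
  have y: "0 < y" using assms by linarith
  have "inverse c = inverse y * (w + (y - w * c) / c)"
    using y \<open>0 < c\<close> by (simp add: field_simps)
  then have "x /\<^sub>R y - S /\<^sub>R c = (x - (w + (y - w * c) / c) *\<^sub>R S) /\<^sub>R y"
    by (simp only: scaleR_diff_right scaleR_scaleR)
  also have "\<dots> = ((x - w *\<^sub>R S) - ((y - w * c) / c) *\<^sub>R S) /\<^sub>R y"
    by (simp only: scaleR_add_left diff_diff_eq)
  finally have "norm (x /\<^sub>R y - S /\<^sub>R c) = norm ((x - w *\<^sub>R S) - ((y - w * c) / c) *\<^sub>R S) / y"
    using y by (simp add: divide_inverse_commute)
  also have "\<dots> \<le> (norm (x - w *\<^sub>R S) + \<bar>y - w * c\<bar> * norm S / c) / \<beta>"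
  proof (rule frac_le)
    show "norm ((x - w *\<^sub>R S) - ((y - w * c) / c) *\<^sub>R S) \<le> norm (x - w *\<^sub>R S) + \<bar>y - w * c\<bar> * norm S / c"
      using norm_triangle_ineq4[of "x - w *\<^sub>R S" "((y - w * c) / c) *\<^sub>R S"] \<open>0 < c\<close> by simp
  qed (use assms in auto)
  finally show ?thesis .
qed

theorem theorem2p7:
  fixes f :: "'v::finite \<Rightarrow> real^'d \<Rightarrow> real"
    and E :: "nat \<Rightarrow> ('v \<times> 'v) set"
    and \<alpha> \<tau> \<zeta> :: "nat \<Rightarrow> real"
    and x xh wh zh :: "nat \<Rightarrow> 'v \<Rightarrow> real^'d"
    and y yh :: "nat \<Rightarrow> 'v \<Rightarrow> real"
  assumes f_convex: "\<And>i. convex_on UNIV (f i)"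
    and f_diff: "\<And>i u. f i differentiable at u"
    and minimizers_nonempty: "minimizers (\<lambda>u. \<Sum>i\<in>UNIV. f i u) \<noteq> {}"
    and \<alpha>_pos: "\<And>t. t \<ge> 1 \<Longrightarrow> \<alpha> t > 0"
    and \<tau>_nonneg: "\<And>t. \<tau> t \<ge> 0"
    and \<zeta>_nonneg: "\<And>t. \<zeta> t \<ge> 0"
    and algorithm: "event_triggered_gradient_push f E \<alpha> \<tau> \<zeta> x xh y yh wh zh"
    and gradient_bound: "\<And>i. \<exists>D>0. \<forall>u. norm (gradient (f i) u) \<le> D"
    and graph: "uniformly_strongly_connected E"
    and \<alpha>_mono: "decseq (\<lambda>t. \<alpha> (t + 1))"
    and \<alpha>_sum: "filterlim (\<lambda>n. \<Sum>t<n. \<alpha> (t + 1)) at_top sequentially"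
    and \<alpha>_sq_sum: "summable (\<lambda>t. (\<alpha> (t + 1))\<^sup>2)"
    and \<tau>_mono: "decseq \<tau>"
    and \<tau>_sum: "summable (\<lambda>t. \<tau> (t + 1))"
    and \<zeta>_mono: "decseq \<zeta>"
    and \<zeta>_weighted_sum: "summable (\<lambda>t. real (t + 1) powr (3/2) * \<zeta> (t + 1))"
    and \<zeta>_summable: "summable (\<lambda>t. \<zeta> (t + 1))"
    and \<zeta>_sum: "(\<Sum>t. \<zeta> (t + 1)) < 1"
  shows "\<exists>xstar\<in>minimizers (\<lambda>u. \<Sum>i\<in>UNIV. f i u). \<forall>i. (\<lambda>t. zh t i) \<longlonglongrightarrow> xstar"
proof -
  define m where "m = real CARD('v)"
  have m: "0 < m" by (simp add: m_def)
  define a where "a t = \<alpha> (t + 1)" for t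
  have a: "decseq a" "\<And>t. 0 \<le> a t" "summable (\<lambda>t. (a t)\<^sup>2)" "\<And>t. 0 < a t"
    using \<alpha>_mono \<alpha>_pos \<alpha>_sq_sum by (auto simp: a_def[abs_def] less_imp_le)
  define S where "S t = (\<Sum>i\<in>UNIV. xh t i)" for t
  define c where "c t = (\<Sum>i\<in>UNIV. yh t i)" for t
  have init: "yh 0 i = 1" for i
    using algorithm by (simp add: event_triggered_gradient_push_def)
  have update:
    "wh (Suc t) i = push_step (E t) (xh t) i"
    "y (Suc t) i = push_step (E t) (yh t) i"
    "zh (Suc t) i = wh (Suc t) i /\<^sub>R y (Suc t) i"
    "x (Suc t) i = push_step (E t) (xh t) i - a t *\<^sub>R gradient (f i) (zh (Suc t) i)" for t i
    using algorithm by (auto simp: event_triggered_gradient_push_def push_step_def a_def)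
  have x_trigger: "norm (xh (Suc t) i - x (Suc t) i) \<le> \<tau> (t + 1)" for t i
  proof -
    have "xh (Suc t) i = (if norm (x (Suc t) i - xh t i) \<ge> \<tau> (Suc t) then x (Suc t) i else xh t i)"
      using algorithm by (simp add: event_triggered_gradient_push_def)
    then show ?thesis using \<tau>_nonneg[of "Suc t"] by (auto simp: norm_minus_commute)
  qed
  have y_trigger: "norm (yh (Suc t) i - push_step (E t) (yh t) i) \<le> \<zeta> (t + 1)" for t i
  proof -
    have "yh (Suc t) i = (if \<bar>y (Suc t) i - yh t i\<bar> \<ge> \<zeta> (Suc t) then y (Suc t) i else yh t i)"
      using algorithm by (simp add: event_triggered_gradient_push_def)
    then show ?thesis using \<zeta>_nonneg[of "Suc t"] by (auto simp: update(2))
  qed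
  obtain D where D: "0 \<le> D" "\<And>i u. norm (gradient (f i) u) \<le> D"
  proof -
    from gradient_bound obtain Di where Di: "\<And>i. 0 < Di i" "\<And>i u. norm (gradient (f i) u) \<le> Di i" by metis
    have "Di i \<le> (\<Sum>i\<in>UNIV. Di i)" for i
      using Di(1) by (intro member_le_sum) (auto intro: less_imp_le)
    then have "norm (gradient (f i) u) \<le> (\<Sum>i\<in>UNIV. Di i)" for i u using Di(2) order_trans by blast
    then show thesis using Di(1) by (intro that[of "\<Sum>i\<in>UNIV. Di i"] sum_nonneg) (auto intro: less_imp_le)
  qed
  define hx where "hx t = m * (\<tau> (t + 1) + D * a t)" for t
  define hy where "hy t = m * \<zeta> (t + 1)" for t
  have x_error: "(\<Sum>i\<in>UNIV. norm (xh (Suc t) i - push_step (E t) (xh t) i)) \<le> hx t" for t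
    unfolding hx_def m_def
  proof (rule sum_bounded_above)
    fix i
    have "xh (Suc t) i - push_step (E t) (xh t) i
        = (xh (Suc t) i - x (Suc t) i) - a t *\<^sub>R gradient (f i) (zh (Suc t) i)"
      by (simp add: update(4))
    also have "norm \<dots> \<le> \<tau> (t + 1) + D * a t"
      using x_trigger[of t i] mult_left_mono[OF D(2)[of i "zh (Suc t) i"] a(2)[of t]] a(2)[of t]
      by (intro order_trans[OF norm_triangle_ineq4]) (simp add: mult.commute)
    finally show "norm (xh (Suc t) i - push_step (E t) (xh t) i) \<le> \<tau> (t + 1) + D * a t" .
  qed
  have y_error: "(\<Sum>i\<in>UNIV. norm (yh (Suc t) i - push_step (E t) (yh t) i)) \<le> hy t" for t
    unfolding hy_def m_def using y_trigger by (rule sum_bounded_above)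
  have \<tau>'_mono: "decseq (\<lambda>t. \<tau> (t + 1))" and \<zeta>'_mono: "decseq (\<lambda>t. \<zeta> (t + 1))"
    using \<tau>_mono \<zeta>_mono by (auto simp: decseq_def)
  have hx_mono: "decseq hx"
    unfolding hx_def[abs_def] decseq_def
    using decseqD[OF \<tau>'_mono] decseqD[OF a(1)] D(1) m by (auto intro!: mult_left_mono add_mono)
  have hy_mono: "decseq hy"
    unfolding hy_def[abs_def] decseq_def using decseqD[OF \<zeta>'_mono] m by (auto intro!: mult_left_mono)
  obtain W \<eta> where mixing: "uniformly_mixing E W \<eta>"
    by (rule uniformly_strongly_connected_mixing[OF graph])
  then have \<eta>: "0 < \<eta>" by (rule uniformly_mixing_pos)

  have hy_weighted_sum: "summable (\<lambda>t. real (Suc t) * hy t)"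
  proof (rule summable_comparison_test'[OF summable_mult[OF \<zeta>_weighted_sum, of m], of 0])
    fix t
    have "real (t + 1) powr 1 \<le> real (t + 1) powr (3/2)" by (intro powr_mono) auto
    then have "real (Suc t) * \<zeta> (t + 1) \<le> real (t + 1) powr (3/2) * \<zeta> (t + 1)"
      using \<zeta>_nonneg[of "t + 1"] by (intro mult_right_mono) auto
    from mult_left_mono[OF this, of m]
    show "norm (real (Suc t) * hy t) \<le> m * (real (t + 1) powr (3/2) * \<zeta> (t + 1))"
      using m \<zeta>_nonneg[of "t + 1"] by (simp add: hy_def abs_mult mult_ac del: of_nat_Suc)
  qed
  have c_step: "\<bar>c (Suc t) - c t\<bar> \<le> hy t" for t
    using total_increment[of yh t E, OF y_error] by (simp add: c_def)
  obtain cinf where c_lim: "c \<longlonglongrightarrow> cinf" and c_sum: "summable (\<lambda>t. \<bar>c t - cinf\<bar>)"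
    by (rule limit_with_summable_error[OF c_step hy_weighted_sum])
  have cinf: "0 < cinf"
  proof -
    have "m - m * (\<Sum>s<t. \<zeta> (s + 1)) \<le> c t" for t
    proof (induction t)
      case 0
      then show ?case by (simp add: c_def init m_def)
    next
      case (Suc t)
      then show ?case using c_step[of t] by (simp add: hy_def algebra_simps)
    qed
    moreover have "(\<lambda>t. m - m * (\<Sum>s<t. \<zeta> (s + 1))) \<longlonglongrightarrow> m - m * (\<Sum>s. \<zeta> (s + 1))"
      by (intro tendsto_intros summable_LIMSEQ \<zeta>_summable)
    ultimately have "m - m * (\<Sum>s. \<zeta> (s + 1)) \<le> cinf"
      using c_lim by (intro LIMSEQ_le) auto
    moreover have "m * (\<Sum>s. \<zeta> (s + 1)) < m * 1" using m \<zeta>_sum by (intro mult_strict_left_mono)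
    ultimately show ?thesis by simp
  qed

  \<comment> \<open>The total error of \<open>y\<close>: lack of consensus, and total not yet at its limit.\<close>
  define \<delta> where "\<delta> t = spread E yh t + \<bar>c t - cinf\<bar>" for t
  have "summable (\<lambda>t. 1 * spread E yh t)"
    by (rule spread_weighted_summable[OF mixing y_error hy_mono])
      (use summable_mult[OF \<zeta>_summable, of m] in \<open>auto simp: decseq_def hy_def[abs_def]\<close>)
  then have \<delta>_sum: "summable \<delta>" unfolding \<delta>_def[abs_def] using c_sum by (intro summable_add) auto
  then have \<delta>_lim: "\<delta> \<longlonglongrightarrow> 0" by (rule summable_LIMSEQ_zero)
  have \<delta>_nonneg: "0 \<le> \<delta> t" for t by (simp add: \<delta>_def spread_nonneg)
  have y_near: "\<bar>y (Suc t) i - push_weight E (Suc t) i * cinf\<bar> \<le> \<delta> t" for t i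
  proof -
    let ?w = "push_weight E (Suc t) i"
    have "\<bar>y (Suc t) i - ?w * c t\<bar> \<le> spread E yh t"
      using push_step_near_weight[of E t yh i] by (simp add: update(2) c_def)
    moreover have "\<bar>?w * c t - ?w * cinf\<bar> \<le> \<bar>c t - cinf\<bar>"
      using mult_right_mono[OF push_weight_le_1[of E "Suc t" i], of "\<bar>c t - cinf\<bar>"]
      by (simp add: right_diff_distrib[symmetric] abs_mult push_weight_nonneg)
    ultimately show ?thesis unfolding \<delta>_def by linarith
  qed
  define \<beta> where "\<beta> = \<eta> * cinf / 2"
  have \<beta>: "0 < \<beta>" using \<eta> cinf by (simp add: \<beta>_def)
  \<comment> \<open>Half of the asymptotic lower bound \<open>\<eta> * cinf\<close> is left once \<open>\<delta> t < \<beta>\<close>; the bound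
    \<open>\<eta>\<close> on the weights takes one full window to establish.\<close>
  obtain T where T: "\<And>t i. t \<ge> T \<Longrightarrow> \<beta> \<le> y (Suc t) i"
  proof -
    from LIMSEQ_D[OF \<delta>_lim \<beta>] obtain N where N: "\<And>t. t \<ge> N \<Longrightarrow> \<delta> t < \<beta>"
      using \<delta>_nonneg by fastforce
    have "\<beta> \<le> y (Suc t) i" if "t \<ge> max N W" for t i
    proof -
      have "\<eta> * cinf \<le> push_weight E (Suc t) i * cinf"
        using that cinf by (intro mult_right_mono push_weight_lower[OF mixing]) auto
      moreover have "\<delta> t < \<beta>" using that by (intro N) simp
      ultimately show ?thesis using y_near[of t i] by (simp add: \<beta>_def)
    qed
    then show thesis by (rule that)
  qed
  define u where "u t = S t /\<^sub>R cinf" for t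
  have z_near: "norm (zh (Suc t) i - u t) \<le> (spread E xh t + \<delta> t * norm (S t) / cinf) / \<beta>"
    if "t \<ge> T" for t i
  proof -
    let ?w = "push_weight E (Suc t) i"
    have "norm (zh (Suc t) i - u t)
        \<le> (norm (wh (Suc t) i - ?w *\<^sub>R S t) + \<bar>y (Suc t) i - ?w * cinf\<bar> * norm (S t) / cinf) / \<beta>"
      unfolding update(3) u_def by (rule ratio_of_near_multiples[OF \<beta> T[OF that] cinf])
    also have "\<dots> \<le> (spread E xh t + \<delta> t * norm (S t) / cinf) / \<beta>"
      using \<beta> cinf y_near push_step_near_weight[of E t xh i]
      by (intro divide_right_mono add_mono mult_right_mono) (auto simp: update(1) S_def)
    finally show ?thesis .
  qed

  have \<tau>'_sum: "summable (\<lambda>t. m * \<tau> (t + 1))" using \<tau>_sum by (rule summable_mult)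
  have "norm (S (Suc t) - S t) \<le> m * \<tau> (t + 1) + (m * D) * a t" for t
    using total_increment[of xh t E, OF x_error] by (simp add: S_def hx_def algebra_simps)
  from step_times_drift_bounded[OF a(1-3) \<tau>'_sum _ _ this]
  obtain K where K: "\<And>t. a t * norm (S t) \<le> K" using m D(1) \<tau>_nonneg by auto
  have a_le: "a t \<le> a 0" for t using a(1) by (rule decseqD) simp
  have "summable (\<lambda>t. a t * hx t)"
  proof -
    have "summable (\<lambda>t. a t * \<tau> (t + 1))"
      by (rule summable_comparison_test'[OF summable_mult[OF \<tau>_sum, of "a 0"], of 0])
        (use a_le a(2) \<tau>_nonneg in \<open>auto intro: mult_right_mono\<close>)
    then have "summable (\<lambda>t. m * (a t * \<tau> (t + 1)) + m * D * (a t)\<^sup>2)"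
      using a(3) by (intro summable_add summable_mult)
    then show ?thesis by (simp add: hx_def[abs_def] algebra_simps power2_eq_square)
  qed
  then have x_spread_sum: "summable (\<lambda>t. a t * spread E xh t)"
    by (intro spread_weighted_summable[OF mixing x_error hx_mono] a)
  have a_lim: "a \<longlonglongrightarrow> 0"
  proof -
    have "(\<lambda>t. sqrt ((a t)\<^sup>2)) \<longlonglongrightarrow> sqrt 0"
      using summable_LIMSEQ_zero[OF a(3)] by (rule tendsto_real_sqrt)
    then show ?thesis using a(2) by simp
  qed
  have "hx \<longlonglongrightarrow> m * (0 + D * 0)"
    unfolding hx_def[abs_def] using summable_LIMSEQ_zero[OF \<tau>_sum] a_lim by (intro tendsto_intros)
  then have x_spread_lim: "spread E xh \<longlonglongrightarrow> 0"
    by (intro spread_tendsto_zero[OF mixing x_error hx_mono]) simp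
  \<comment> \<open>The factor \<open>norm (S t)\<close> of \<open>\<delta> t\<close> need not be bounded at this point, but \<open>a t * norm (S t) \<le> K\<close> is.\<close>
  have z_sum: "summable (\<lambda>t. a (t + T) / cinf * norm (zh (Suc (t + T)) i - u (t + T)))" for i
  proof -
    define g where "g t = (a t * spread E xh t + K / cinf * \<delta> t) / (\<beta> * cinf)" for t
    have "summable g"
      unfolding g_def[abs_def] by (intro summable_divide summable_add summable_mult x_spread_sum \<delta>_sum)
    then have "summable (\<lambda>t. g (t + T))" by (simp add: summable_iff_shift)
    then show ?thesis
    proof (rule summable_comparison_test'[where N = 0])
      fix t
      define k where "k = t + T"
      have "a k / cinf * norm (zh (Suc k) i - u k)
          \<le> a k / cinf * ((spread E xh k + \<delta> k * norm (S k) / cinf) / \<beta>)"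
        using a(2) cinf by (intro mult_left_mono z_near) (auto simp: k_def)
      also have "\<dots> = (a k * spread E xh k + (a k * norm (S k)) / cinf * \<delta> k) / (\<beta> * cinf)"
        using \<beta> cinf by (simp add: field_simps)
      also have "\<dots> \<le> g k"
        unfolding g_def using \<beta> cinf K \<delta>_nonneg
        by (intro divide_right_mono add_left_mono mult_right_mono) auto
      finally show "norm (a (t + T) / cinf * norm (zh (Suc (t + T)) i - u (t + T))) \<le> g (t + T)"
        using a(2)[of k] cinf by (simp add: k_def)
    qed
  qed
  define \<nu> where "\<nu> t = (\<Sum>i\<in>UNIV. xh (Suc t) i - x (Suc t) i) /\<^sub>R cinf" for t
  have u_step: "u (Suc t) = u t + \<nu> t - (a t / cinf) *\<^sub>R (\<Sum>i\<in>UNIV. gradient (f i) (zh (Suc t) i))" for t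
  proof -
    have "S (Suc t) = S t + (\<Sum>i\<in>UNIV. xh (Suc t) i - x (Suc t) i)
        - a t *\<^sub>R (\<Sum>i\<in>UNIV. gradient (f i) (zh (Suc t) i))"
      by (simp add: S_def update(4) sum_subtractf sum_push_step scaleR_sum_right)
    then have "u (Suc t) = (S t + (\<Sum>i\<in>UNIV. xh (Suc t) i - x (Suc t) i)
        - a t *\<^sub>R (\<Sum>i\<in>UNIV. gradient (f i) (zh (Suc t) i))) /\<^sub>R cinf"
      by (simp add: u_def)
    then show ?thesis
      by (simp only: u_def \<nu>_def scaleR_add_right scaleR_diff_right scaleR_scaleR divide_inverse_commute)
  qed
  have \<nu>_sum: "summable (\<lambda>t. norm (\<nu> t))"
  proof (rule summable_comparison_test'[OF summable_divide[OF \<tau>'_sum, of cinf], of 0])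
    fix t
    have "norm (\<Sum>i\<in>UNIV. xh (Suc t) i - x (Suc t) i) \<le> m * \<tau> (t + 1)"
      unfolding m_def by (rule sum_norm_bound) (rule x_trigger)
    then show "norm (norm (\<nu> t)) \<le> m * \<tau> (t + 1) / cinf"
      using cinf by (simp add: \<nu>_def divide_inverse_commute)
  qed
  have a_not_summable: "\<not> summable (\<lambda>t. a (t + T) / cinf)"
  proof
    assume "summable (\<lambda>t. a (t + T) / cinf)"
    from summable_mult[OF this, of cinf] have "summable (\<lambda>t. a (t + T))" using cinf by simp
    then have "summable a" by (simp add: summable_iff_shift)
    then have "(\<lambda>n. \<Sum>t<n. \<alpha> (t + 1)) \<longlonglongrightarrow> suminf a"
      unfolding a_def[abs_def] by (rule summable_LIMSEQ)
    with \<alpha>_sum show False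
      using not_tendsto_and_filterlim_at_infinity[OF sequentially_bot] filterlim_at_top_imp_at_infinity by blast
  qed
  have a_sq_sum: "summable (\<lambda>t. (a (t + T) / cinf)\<^sup>2)"
  proof -
    have "summable (\<lambda>t. (a (t + T))\<^sup>2)"
      using a(3) summable_iff_shift[of "\<lambda>t. (a t)\<^sup>2" T] by simp
    then show ?thesis by (simp add: power_divide summable_divide)
  qed
  have \<nu>_shift_sum: "summable (\<lambda>t. norm (\<nu> (t + T)))"
    using \<nu>_sum summable_iff_shift[of "\<lambda>t. norm (\<nu> t)" T] by simp
  have u_shift_step: "u (Suc t + T) = u (t + T) + \<nu> (t + T)
      - (a (t + T) / cinf) *\<^sub>R (\<Sum>i\<in>UNIV. gradient (f i) (zh (Suc (t + T)) i))" for t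
    using u_step[of "t + T"] by simp
  have a_shift_nonneg: "0 \<le> a (t + T) / cinf" for t
    using a(2) cinf by simp
  obtain v where v: "v \<in> minimizers (\<lambda>u. \<Sum>i\<in>UNIV. f i u)" "(\<lambda>t. u (t + T)) \<longlonglongrightarrow> v"
    by (rule perturbed_gradient_descent_converges[of f D "\<lambda>t. u (t + T)" "\<lambda>t. \<nu> (t + T)"
          "\<lambda>t. a (t + T) / cinf" "\<lambda>t. zh (Suc (t + T))", OF f_convex f_diff D(2) minimizers_nonempty
          u_shift_step a_shift_nonneg a_not_summable a_sq_sum \<nu>_shift_sum z_sum])
  from v(2) have u_lim: "u \<longlonglongrightarrow> v" by (rule LIMSEQ_offset)

  have "(\<lambda>t. zh t i) \<longlonglongrightarrow> v" for i
  proof -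
    have "S = (\<lambda>t. cinf *\<^sub>R u t)" using cinf by (simp add: u_def)
    \<comment> \<open>Convergence of \<open>u\<close> bounds \<open>S\<close>, so vanishing, rather than summable, errors now suffice.\<close>
    then have "S \<longlonglongrightarrow> cinf *\<^sub>R v" using u_lim by (simp add: tendsto_intros)
    then have "(\<lambda>t. (spread E xh t + \<delta> t * norm (S t) / cinf) / \<beta>) \<longlonglongrightarrow> (0 + 0 * norm (cinf *\<^sub>R v) / cinf) / \<beta>"
      using cinf \<beta> by (intro tendsto_intros x_spread_lim \<delta>_lim) auto
    then have "(\<lambda>t. (spread E xh t + \<delta> t * norm (S t) / cinf) / \<beta>) \<longlonglongrightarrow> 0" by simp
    moreover have "\<forall>\<^sub>F t in sequentially. norm (zh (Suc t) i - u t)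
        \<le> (spread E xh t + \<delta> t * norm (S t) / cinf) / \<beta>"
      by (rule eventually_sequentiallyI[of T]) (rule z_near)
    ultimately have "(\<lambda>t. zh (Suc t) i - u t) \<longlonglongrightarrow> 0" by (rule Lim_null_comparison[rotated])
    from tendsto_add[OF this u_lim] have "(\<lambda>t. zh (Suc t) i) \<longlonglongrightarrow> v" by simp
    then show ?thesis by (rule LIMSEQ_imp_Suc)
  qed
  with v(1) show ?thesis by blast
qed

end
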